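(* Let $N\ge1$ be an integer and $p=1+2/N$. For $\alpha\in(0,1)$ let $\mathcal{G}_\alpha$ be the set of all nonnegative $v\in L^1(\mathbb{R}^N)$ such that the problem $$\partial_t^{\alpha}u-\Delta u=u^p\ \text{ in }(0,\infty)\times\mathbb{R}^N,\qquad u(0)=v\ \text{ on }\mathbb{R}^N$$ possesses a nonnegative global-in-time solution, i.e. a solution in $(0,\infty)$ (in the mild sense defined in the context). Then there exist constants $C>0$ and $\alpha_0\in(0,1)$ (depending only on $N$) such that for all $\alpha\in(\alpha_0,1)$, $$\sup_{v\in\mathcal{G}_\alpha}\|v\|_{L^1(\mathbb{R}^N)}\le C(1-\alpha)^{N/2}.$$ In particular, $$\lim_{\alpha\to1}\ \sup_{v\in\mathcal{G}_\alpha}\|v\|_{L^1(\mathbb{R}^N)}=0.$$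
   Context: $\partial_t^\alpha$ is the Caputo derivative of order $\alpha\in(0,1)$, $(\partial_t^{\alpha}f)(t)=\frac{1}{\Gamma(1-\alpha)}\frac{d}{dt}\int_0^t(t-\tau)^{-\alpha}(f(\tau)-f(0))\,d\tau$; it enters only through the following notion of solution. Let $G(t,x)=(4\pi t)^{-N/2}\exp(-|x|^2/(4t))$ for $t>0$, $x\in\mathbb{R}^N$, and $e^{t\Delta}v=G(t,\cdot)*v$. For $\theta>0$ let $$\psi_\alpha(\theta)=\frac1\pi\sum_{k=1}^\infty(-1)^{k-1}\theta^{-k\alpha-1}\frac{\Gamma(k\alpha+1)}{k!}\sin(k\pi\alpha),\qquad h_\alpha(\theta)=\frac1\alpha\theta^{-1-1/\alpha}\psi_\alpha(\theta^{-1/\alpha}).$$ The function $h_\alpha$ is a probability density on $(0,\infty)$. For $t>0$ define $$P_\alpha(t)=\int_0^\infty h_\alpha(\theta)e^{t^\alpha\theta\Delta}\,d\theta,\qquad S_\alpha(t)=\int_0^\infty\theta h_\alpha(\theta)e^{t^\alpha\theta\Delta}\,d\theta .$$ Definition of solution. Let $u_0$ be a nonnegative measurable function on $\mathbb{R}^N$ and $T\in(0,\infty]$. A nonnegative measurable function $u$ on $(0,T)\times\mathbb{R}^N$ is a solution in $(0,T)$ of $\partial_t^\alpha u-\Delta u=u^p$, $u(0)=u_0$, if $u(t,\cdot)$ is integrable on $\mathbb{R}^N$ for each $t\in(0,T)$ and $$u(t,x)=[P_\alpha(t)u_0](x)+\alpha\int_0^t(t-\tau)^{\alpha-1}[S_\alpha(t-\tau)u^p(\tau,\cdot)](x)\,d\tau$$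 for every $t\in(0,T)$ and almost every $x\in\mathbb{R}^N$. *)

theory Defs
  imports "HOL-Analysis.Analysis"
begin

definition heat_kernel :: "real \<Rightarrow> real ^ 'n \<Rightarrow> real" where
  "heat_kernel t x =
     (4 * pi * t) powr (- (real CARD('n) / 2)) * exp (- (norm x)\<^sup>2 / (4 * t))"

text \<open>
  The operators below are only ever applied to nonnegative functions, so all integrals are
  Lebesgue integrals with values in the extended nonnegative reals; no integrability has to be
  presupposed, and an identity \<open>ennreal a = \<dots>\<close> says that the right-hand side is finite.
\<close>

definition heat_semigroup :: "real \<Rightarrow> (real ^ 'n \<Rightarrow> real) \<Rightarrow> real ^ 'n \<Rightarrow> ennreal" where
  "heat_semigroup t v x = (\<integral>\<^sup>+ y. ennreal (heat_kernel t (x - y) * v y) \<partial>lebesgue)"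

text \<open>The summation index is shifted: the term with index \<open>n\<close> is the one for \<open>k = n + 1\<close>.\<close>

definition psi :: "real \<Rightarrow> real \<Rightarrow> real" where
  "psi \<alpha> \<theta> = (1 / pi) *
     (\<Sum>n. (- 1) ^ n * \<theta> powr (- (real (Suc n) * \<alpha>) - 1)
           * (Gamma (real (Suc n) * \<alpha> + 1) / fact (Suc n)) * sin (real (Suc n) * pi * \<alpha>))"

definition h :: "real \<Rightarrow> real \<Rightarrow> real" where
  "h \<alpha> \<theta> = (1 / \<alpha>) * \<theta> powr (- 1 - 1 / \<alpha>) * psi \<alpha> (\<theta> powr (- (1 / \<alpha>)))"

text \<open>
  For \<open>0 < \<alpha> < 1\<close> the function \<open>h \<alpha>\<close> is a probability density on \<open>{0<..}\<close>; in particular it is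
  nonnegative there, so that \<open>ennreal\<close> truncates nothing in the next two definitions.
\<close>

definition P_op :: "real \<Rightarrow> real \<Rightarrow> (real ^ 'n \<Rightarrow> real) \<Rightarrow> real ^ 'n \<Rightarrow> ennreal" where
  "P_op \<alpha> t v x =
     (\<integral>\<^sup>+ \<theta>\<in>{0<..}. ennreal (h \<alpha> \<theta>) * heat_semigroup (t powr \<alpha> * \<theta>) v x \<partial>lebesgue)"

definition S_op :: "real \<Rightarrow> real \<Rightarrow> (real ^ 'n \<Rightarrow> real) \<Rightarrow> real ^ 'n \<Rightarrow> ennreal" where
  "S_op \<alpha> t v x =
     (\<integral>\<^sup>+ \<theta>\<in>{0<..}. ennreal (\<theta> * h \<alpha> \<theta>) * heat_semigroup (t powr \<alpha> * \<theta>) v x \<partial>lebesgue)"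

text \<open>
  \<open>is_solution \<alpha> p T u0 u\<close>: the function \<open>u\<close> is a (mild) solution on the time interval \<open>(0, T)\<close>,
  where \<open>T = \<infinity>\<close> is allowed, of the equation with Caputo derivative of order \<open>\<alpha>\<close>, nonlinearity
  \<open>u powr p\<close> and initial value \<open>u0\<close>. Values of \<open>u\<close> outside \<open>(0, T)\<close> are irrelevant.
\<close>

definition is_solution ::
    "real \<Rightarrow> real \<Rightarrow> ereal \<Rightarrow> (real ^ 'n \<Rightarrow> real) \<Rightarrow> (real \<Rightarrow> real ^ 'n \<Rightarrow> real) \<Rightarrow> bool" where
  "is_solution \<alpha> p T u0 u \<longleftrightarrow>
     (\<forall>x. 0 \<le> u0 x) \<and> u0 \<in> borel_measurable lebesgue \<and> 0 < T \<and>
     (\<forall>t x. 0 < t \<and> ereal t < T \<longrightarrow> 0 \<le> u t x) \<and>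
     (\<lambda>(t, x). u t x) \<in> borel_measurable (lebesgue_on ({t. 0 < t \<and> ereal t < T} \<times> UNIV)) \<and>
     (\<forall>t. 0 < t \<and> ereal t < T \<longrightarrow>
        integrable lebesgue (u t) \<and>
        (AE x in lebesgue.
           ennreal (u t x) =
             P_op \<alpha> t u0 x +
             ennreal \<alpha> * (\<integral>\<^sup>+ \<tau>\<in>{0<..<t}. ennreal ((t - \<tau>) powr (\<alpha> - 1))
                                     * S_op \<alpha> (t - \<tau>) (\<lambda>y. u \<tau> y powr p) x \<partial>lebesgue)))"

definition global_data :: "real \<Rightarrow> real \<Rightarrow> (real ^ 'n \<Rightarrow> real) set" where
  "global_data p \<alpha> =
     {v. (\<forall>x. 0 \<le> v x) \<and> integrable lebesgue v \<and> (\<exists>u. is_solution \<alpha> p \<infinity> v u)}"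

definition L1_norm :: "(real ^ 'n \<Rightarrow> real) \<Rightarrow> ennreal" where
  "L1_norm v = (\<integral>\<^sup>+ x. ennreal \<bar>v x\<bar> \<partial>lebesgue)"

end

theory Submission
  imports Defs
begin

text \<open>
  Why only little mass is compatible with global existence.  Let \<open>u\<close> be a global solution and
  suppose that \<open>u(t, x) \<ge> m * t powr (- \<alpha> * N / 2)\<close> on the parabolic ball \<open>norm x \<le> t powr (\<alpha> / 2)\<close>
  for all large \<open>t\<close>; the linear part of the integral equation provides this with \<open>m\<close> proportional
  to the initial mass.  Since \<open>p = 1 + 2 / N\<close>, the source \<open>u powr p\<close> at time \<open>\<tau>\<close> then carries at least the
  mass \<open>m powr p * \<tau> powr (- \<alpha>)\<close> up to a factor, spread over a parabolic ball.  Diffusion transports it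
  to the profile at time \<open>t\<close>, and the memory kernel weighs it with \<open>(t - \<tau>) powr (\<alpha> - 1)\<close>.  The integral of
  \<open>(t - \<tau>) powr (\<alpha> - 1) * \<tau> powr (- \<alpha>)\<close> over \<open>0 < \<tau> < t\<close> is of order \<open>1 / (1 - \<alpha>)\<close>: this replaces
  the logarithmic divergence behind critical blow-up for \<open>\<alpha> = 1\<close>.  Hence the constant \<open>m\<close>
  improves to \<open>c * m powr p / (1 - \<alpha>)\<close> (\<open>profile_bound_step\<close>), and iteration makes it arbitrarily large
  as soon as \<open>m powr (2 / N)\<close> exceeds a multiple of \<open>1 - \<alpha>\<close>, that is, as soon as the mass
  exceeds a multiple of \<open>(1 - \<alpha>) powr (N / 2)\<close>.

  A large profile constant contradicts global existence: on a fixed ball and a fixed time interval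
  \<open>[T, 2 * T]\<close> the integral equation yields \<open>K \<mapsto> c * d * K powr p\<close> over time steps of length \<open>d\<close>,
  and for a large start the bounds tend to infinity although the steps add up to at most \<open>T\<close>
  (\<open>local_bound_contradiction\<close>).

  All constants must be uniform as \<open>\<alpha>\<close> tends to \<open>1\<close>.  The kernel \<open>h \<alpha>\<close> enters only through a lower
  bound for the integral of its positive part over \<open>[1/2, 3/2]\<close>
  (\<open>nn_integral_h_near_1_lower_bound\<close>), which expresses that \<open>h \<alpha>\<close> concentrates at \<open>1\<close>.  The
  defining series is useless for this on account of cancellation.  Summing it under the Gamma integral
  taken along a ray of angle \<open>\<phi>\<close> slightly above \<open>pi / 2\<close> gives an absolutely
  convergent integral for \<open>h \<alpha>\<close> (\<open>h_conv_ray_integral\<close>).  Integrated against a tent function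
  it is dominated uniformly in \<open>\<alpha>\<close>, and it converges to a multiple of the integral of a Fejer kernel, which is positive.
\<close>

section \<open>Gamma integrals with a complex scale\<close>

text \<open>
  The series of absolute values sums to \<open>norm g * exp (norm q)\<close>, so the single integrability assumption
  legitimates termwise integration.  It serves twice: once to scale the Gamma integral by a complex
  number and once to sum the series of \<open>h\<close>.
\<close>

lemma exp_series_sums_integral:
  fixes g q :: "'a \<Rightarrow> complex"
  assumes [measurable]: "g \<in> borel_measurable M" "q \<in> borel_measurable M"
    and int: "integrable M (\<lambda>r. norm (g r) * exp (norm (q r)))"
  shows "(\<lambda>n. \<integral>r. g r * (q r ^ n / fact n) \<partial>M) sums (\<integral>r. g r * exp (q r) \<partial>M)"
proof -
  define f where "f n r = g r * (q r ^ n / fact n)" for n r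
  have [measurable]: "f n \<in> borel_measurable M" for n
    unfolding f_def by measurable
  have nf: "norm (f n r) = norm (g r) * (norm (q r) ^ n / fact n)" for n r
    by (simp add: f_def norm_mult norm_divide norm_power)
  have s: "(\<lambda>n. norm (f n r)) sums (norm (g r) * exp (norm (q r)))" for r
    unfolding nf using exp_converges[of "norm (q r)"]
    by (intro sums_mult) (simp add: divide_inverse mult.commute scaleR_conv_of_real)
  have part: "(\<Sum>n<k. norm (f n r)) \<le> norm (g r) * exp (norm (q r))" for k r
    using sum_le_suminf[OF sums_summable[OF s], of "{..<k}" r] sums_unique[OF s, of r] by simp
  have I: "integrable M (f n)" for n
  proof (rule Bochner_Integration.integrable_bound[OF int])
    show "AE r in M. norm (f n r) \<le> norm (norm (g r) * exp (norm (q r)))"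
    proof (intro AE_I2)
      fix r :: 'a
      have "norm (f n r) \<le> (\<Sum>n<Suc n. norm (f n r))"
        by (simp add: sum_nonneg)
      then show "norm (f n r) \<le> norm (norm (g r) * exp (norm (q r)))"
        using part[of r "Suc n"] by simp
    qed
  qed simp
  have sm: "summable (\<lambda>n. \<integral>r. norm (f n r) \<partial>M)"
  proof (rule summableI_nonneg_bounded)
    fix k
    have "(\<Sum>n<k. \<integral>r. norm (f n r) \<partial>M) = (\<integral>r. (\<Sum>n<k. norm (f n r)) \<partial>M)"
      using I by (subst Bochner_Integration.integral_sum) auto
    also have "\<dots> \<le> (\<integral>r. norm (g r) * exp (norm (q r)) \<partial>M)"
      using I int part by (intro integral_mono) auto
    finally show "(\<Sum>n<k. \<integral>r. norm (f n r) \<partial>M) \<le> (\<integral>r. norm (g r) * exp (norm (q r)) \<partial>M)" .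
  qed simp
  have "(\<lambda>n. integral\<^sup>L M (f n)) sums (\<integral>r. (\<Sum>n. f n r) \<partial>M)"
    using I sm s by (intro sums_integral) (auto simp: sums_iff)
  moreover have "(\<Sum>n. f n r) = g r * exp (q r)" for r
  proof -
    have "(\<lambda>n. q r ^ n / fact n) sums exp (q r)"
      using exp_converges[of "q r"]
      by (simp add: divide_inverse mult.commute scaleR_conv_of_real)
    from sums_mult[OF this, of "g r"] show ?thesis
      by (simp add: f_def sums_iff)
  qed
  ultimately show ?thesis by (simp add: f_def[abs_def])
qed

definition gamma_kernel :: "real \<Rightarrow> real \<Rightarrow> real" where
  "gamma_kernel x r = indicator {0<..} r * r powr (x - 1)"

lemma gamma_kernel_measurable [measurable]: "gamma_kernel x \<in> borel_measurable borel"
  unfolding gamma_kernel_def[abs_def] by measurable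

lemma gamma_kernel_nonneg [simp]: "0 \<le> gamma_kernel x r"
  by (simp add: gamma_kernel_def)

lemma gamma_kernel_add: "gamma_kernel x r * r powr y = gamma_kernel (x + y) r"
  by (auto simp: gamma_kernel_def indicator_def algebra_simps simp flip: powr_add)

lemma has_bochner_integral_Gamma_scaled:
  assumes "x > 0" "c > 0"
  shows "has_bochner_integral lborel (\<lambda>r. gamma_kernel x r * exp (- (c * r))) (Gamma x / c powr x)"
proof -
  let ?f = "\<lambda>r. gamma_kernel x r * exp (- r)"
  have "has_bochner_integral lborel ?f (Gamma x)"
  proof (rule has_bochner_integral_nn_integral)
    have "(\<integral>\<^sup>+ r. ennreal (?f r) \<partial>lborel)
      = (\<integral>\<^sup>+ r. ennreal (indicator {0..} r * r powr (x - 1) / exp r) \<partial>lborel)"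
      by (intro nn_integral_cong) (auto simp: gamma_kernel_def indicator_def exp_minus field_simps)
    then show "(\<integral>\<^sup>+ r. ennreal (?f r) \<partial>lborel) = ennreal (Gamma x)"
      using Gamma_conv_nn_integral_real[OF \<open>x > 0\<close>] by simp
  qed (use assms in \<open>auto simp: less_imp_le Gamma_real_pos\<close>)
  then have "has_bochner_integral lborel (\<lambda>r. ?f (0 + c * r)) (Gamma x /\<^sub>R \<bar>c\<bar>)"
    using assms by (subst lborel_has_bochner_integral_real_affine_iff[symmetric]) auto
  from has_bochner_integral_mult_right[OF this, of "c powr (1 - x)"]
  have "has_bochner_integral lborel (\<lambda>r. c powr (1 - x) * ?f (c * r)) (c powr (1 - x) * (Gamma x / c))"
    using assms by (simp add: divide_inverse mult.commute)
  moreover have "c powr (1 - x) * ?f (c * r) = gamma_kernel x r * exp (- (c * r))" for r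
    using assms by (auto simp: gamma_kernel_def indicator_def powr_mult zero_less_mult_iff simp flip: powr_add)
  moreover have "c powr (1 - x) * (Gamma x / c) = Gamma x / c powr x"
    using assms by (simp add: powr_diff)
  ultimately show ?thesis by simp
qed

lemma integrable_gamma_kernel:
  assumes "x > 0" "c > 0"
  shows "integrable lborel (\<lambda>r. gamma_kernel x r * exp (- (c * r)))"
  using has_bochner_integral_Gamma_scaled[OF assms] by (rule integrable.intros)

text \<open>
  The Gamma integral along a ray.  Expanding \<open>exp (- w * r)\<close> about a real scale \<open>c\<close> turns the claim into
  the binomial series of \<open>(w / c) powr (- x)\<close>; this needs \<open>norm (w - c) < c\<close>, which holds for all
  sufficiently large real \<open>c\<close> because \<open>w\<close> lies in the open right half-plane.
\<close>

lemma integral_Gamma_complex_scaled: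
  fixes w :: complex
  assumes x: "x > 0" and w: "Re w > 0"
  shows "(\<integral>r. of_real (gamma_kernel x r) * exp (- (w * of_real r)) \<partial>lborel)
    = of_real (Gamma x) * w powr (- of_real x)"
proof -
  \<comment> \<open>twice the value at which \<open>w\<close> lies on the circle of radius \<open>c\<close> about \<open>c\<close>\<close>
  define c where "c = (norm w)\<^sup>2 / Re w"
  have c: "c > 0" using w unfolding c_def by (intro divide_pos_pos) auto
  have "(norm (w - of_real c))\<^sup>2 = (norm w)\<^sup>2 - 2 * c * Re w + c\<^sup>2"
    by (simp add: cmod_power2 algebra_simps power2_diff)
  also have "\<dots> = c\<^sup>2 - (norm w)\<^sup>2"
    using w by (simp add: c_def)
  also have "\<dots> < c\<^sup>2" using w by auto
  finally have less: "norm (of_real c - w) < c"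
    using c by (subst norm_minus_commute) (rule power_less_imp_less_base, auto)
  define g where "g r = complex_of_real (gamma_kernel x r * exp (- (c * r)))" for r
  define q where "q r = (of_real c - w) * complex_of_real r" for r
  have [measurable]: "g \<in> borel_measurable lborel" "q \<in> borel_measurable lborel"
    unfolding g_def q_def by measurable
  have ng: "norm (g r) * exp (norm (q r)) = gamma_kernel x r * exp (- ((c - norm (of_real c - w)) * r))" for r
  proof (cases "r > 0")
    case True
    have "norm (q r) = norm (of_real c - w) * r"
      unfolding q_def norm_mult using True by simp
    then show ?thesis
      by (simp add: g_def norm_mult left_diff_distrib flip: exp_add)
  qed (simp add: g_def gamma_kernel_def)
  have "(\<lambda>n. \<integral>r. g r * (q r ^ n / fact n) \<partial>lborel) sums (\<integral>r. g r * exp (q r) \<partial>lborel)"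
    by (rule exp_series_sums_integral)
      (unfold ng, use less x in \<open>auto intro!: integrable_gamma_kernel\<close>)
  also have "(\<lambda>r. g r * exp (q r)) = (\<lambda>r. of_real (gamma_kernel x r) * exp (- (w * of_real r)))"
    by (auto simp: g_def q_def algebra_simps exp_of_real[symmetric] simp flip: exp_add)
  also have "(\<lambda>n. \<integral>r. g r * (q r ^ n / fact n) \<partial>lborel)
    = (\<lambda>n. (Gamma x * c powr (- x)) * (((- of_real x) gchoose n) * (w / c - 1) ^ n))"
  proof
    fix n
    have "g r * (q r ^ n / fact n)
      = (of_real c - w) ^ n / fact n * of_real (gamma_kernel (x + n) r * exp (- (c * r)))" for r
    proof (cases "r > 0")
      case True
      then show ?thesis
        by (simp add: g_def q_def power_mult_distrib powr_realpow mult_ac flip: gamma_kernel_add)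
    qed (simp add: g_def gamma_kernel_def)
    then have "(\<integral>r. g r * (q r ^ n / fact n) \<partial>lborel)
      = (of_real c - w) ^ n / fact n * of_real (Gamma (x + n) / c powr (x + n))"
      using has_bochner_integral_integral_eq[OF has_bochner_integral_Gamma_scaled[of "x + n" c]] x c
      by (simp only: integral_mult_right_zero integral_complex_of_real add_pos_nonneg of_nat_0_le_iff)
    also have "Gamma (x + n) = pochhammer x n * Gamma x"
    proof -
      have "x \<notin> \<int>\<^sub>\<le>\<^sub>0" using x nonpos_Ints_nonpos[of x] by auto
      then show ?thesis
        using Gamma_real_pos[OF x] by (simp add: pochhammer_Gamma)
    qed
    also have "c powr (x + n) = c powr x * c ^ n"
      using c by (simp add: powr_add powr_realpow)
    also have "(of_real c - w) ^ n = (of_real c) ^ n * (-1) ^ n * (w / c - 1) ^ n"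
      using c by (simp add: field_simps flip: power_mult_distrib)
    also have "of_real c ^ n * (- 1) ^ n * (w / c - 1) ^ n / fact n * of_real (pochhammer x n * Gamma x / (c powr x * c ^ n))
       = (Gamma x * c powr (- x)) * (((- of_real x) gchoose n) * (w / c - 1) ^ n)"
      using c by (simp add: gbinomial_pochhammer powr_minus field_simps flip: pochhammer_of_real)
    finally show "(\<integral>r. g r * (q r ^ n / fact n) \<partial>lborel) = \<dots>" .
  qed
  finally have 1: "(\<lambda>n. (Gamma x * c powr (- x)) * (((- of_real x) gchoose n) * (w / c - 1) ^ n))
     sums (\<integral>r. of_real (gamma_kernel x r) * exp (- (w * of_real r)) \<partial>lborel)" .
  have "norm (w / c - 1) < 1"
  proof -
    have "w / c - 1 = - ((of_real c - w) / c)" using c by (simp add: field_simps)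
    then have "norm (w / c - 1) = norm (of_real c - w) / c"
      using c by (simp add: norm_divide)
    then show ?thesis using less c by simp
  qed
  from sums_mult[OF gen_binomial_complex[OF this], of "Gamma x * c powr (- x)" "- of_real x"]
  have "(\<lambda>n. (Gamma x * c powr (- x)) * (((- of_real x) gchoose n) * (w / c - 1) ^ n))
     sums ((Gamma x * c powr (- x)) * (w / c) powr (- of_real x))" by simp
  from sums_unique2[OF 1 this] have "(\<integral>r. of_real (gamma_kernel x r) * exp (- (w * of_real r)) \<partial>lborel)
     = Gamma x * (c powr (- x) * (w / c) powr (- of_real x))" by simp
  also have "c powr (- x) * (w / c) powr (- of_real x) = w powr (- of_real x)"
  proof -
    have "w \<noteq> 0" using w by auto
    have "of_real c powr (- of_real x) * (w / c) powr (- of_real x) = (c * (w / c)) powr (- of_real x)"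
      using c by (subst powr_times_real_left) auto
    then show ?thesis using c by (simp add: powr_of_real flip: of_real_minus)
  qed
  finally show ?thesis by simp
qed

section \<open>The subordination density as an integral along a ray\<close>

text \<open>
  Since \<open>\<alpha> < 1\<close>, the factor \<open>exp (\<theta> * r powr \<alpha>)\<close> is harmless against any exponential decay in \<open>r\<close>.
\<close>

lemma powr_le_linear_plus_const:
  assumes "0 < \<alpha>" "\<alpha> < (1::real)" "0 < \<delta>" "0 \<le> \<theta>"
  obtains K where "\<And>r. 0 < r \<Longrightarrow> \<theta> * r powr \<alpha> \<le> \<delta> * r + K"
proof -
  define R where "R = (\<theta> / \<delta>) powr (1 / (1 - \<alpha>))"
  have "\<theta> * r powr \<alpha> \<le> \<delta> * r + \<theta> * R powr \<alpha>" if "0 < r" for r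
  proof (cases "R \<le> r")
    case True
    have "\<theta> / \<delta> = R powr (1 - \<alpha>)"
      using assms by (simp add: R_def powr_powr)
    also have "\<dots> \<le> r powr (1 - \<alpha>)"
      using True assms by (intro powr_mono2) (auto simp: R_def)
    finally have "\<theta> \<le> \<delta> * r powr (1 - \<alpha>)"
      using assms by (simp add: field_simps)
    then have "\<theta> * r powr \<alpha> \<le> \<delta> * r powr (1 - \<alpha>) * r powr \<alpha>"
      by (intro mult_right_mono) auto
    also have "\<dots> = \<delta> * r"
      using that by (simp add: mult.assoc flip: powr_add)
    finally show ?thesis using assms by (simp add: add_increasing2)
  next
    case False
    then have "\<theta> * r powr \<alpha> \<le> \<theta> * R powr \<alpha>"
      using assms that by (intro mult_left_mono powr_mono2) auto
    then show ?thesis using that assms by (simp add: add_increasing)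
  qed
  then show ?thesis using that by blast
qed

lemma integrable_gamma_kernel_exp_powr:
  assumes "0 < \<alpha>" "\<alpha> < 1" "0 < c" "0 \<le> \<theta>"
  shows "integrable lborel (\<lambda>r. gamma_kernel \<alpha> r * exp (- (c * r)) * exp (\<theta> * r powr \<alpha>))"
proof -
  obtain K where K: "\<And>r. 0 < r \<Longrightarrow> \<theta> * r powr \<alpha> \<le> c / 2 * r + K"
    using powr_le_linear_plus_const[of \<alpha> "c / 2" \<theta>] assms by auto
  have "integrable lborel (\<lambda>r. exp K * (gamma_kernel \<alpha> r * exp (- (c / 2 * r))))"
    using assms by (intro integrable_mult_right integrable_gamma_kernel) auto
  then show ?thesis
  proof (rule Bochner_Integration.integrable_bound)
    show "AE r in lborel. norm (gamma_kernel \<alpha> r * exp (- (c * r)) * exp (\<theta> * r powr \<alpha>))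
        \<le> norm (exp K * (gamma_kernel \<alpha> r * exp (- (c / 2 * r))))"
    proof (intro AE_I2)
      fix r :: real
      show "norm (gamma_kernel \<alpha> r * exp (- (c * r)) * exp (\<theta> * r powr \<alpha>))
        \<le> norm (exp K * (gamma_kernel \<alpha> r * exp (- (c / 2 * r))))"
      proof (cases "0 < r")
        case True
        have "exp (- (c * r)) * exp (\<theta> * r powr \<alpha>) \<le> exp K * exp (- (c / 2 * r))"
          using K[OF True] by (simp flip: exp_add)
        from mult_left_mono[OF this gamma_kernel_nonneg[of \<alpha> r]] show ?thesis
          by (simp add: abs_mult mult_ac)
      qed (simp add: gamma_kernel_def)
    qed
  qed measurable
qed

text \<open>
  Substituting \<open>s = r * cis \<phi>\<close> for the complex variable of the Hankel-type integral of
  \<open>exp (s - \<theta> * s powr \<alpha>) * s powr (\<alpha> - 1)\<close> gives this integrand.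
\<close>

definition ray_integrand :: "real \<Rightarrow> real \<Rightarrow> real \<Rightarrow> real \<Rightarrow> complex" where
  "ray_integrand \<alpha> \<phi> \<theta> r = of_real (gamma_kernel \<alpha> r) * cis (\<phi> * \<alpha>) * exp (cis \<phi> * of_real r)
     * exp (- (of_real \<theta> * (of_real (r powr \<alpha>) * cis (\<phi> * \<alpha>))))"

text \<open>
  Summing the series in \<open>\<theta>\<close> under the integral: the \<open>n\<close>-th term is a Gamma integral with exponent
  \<open>(n + 1) * \<alpha>\<close> along the ray, and the two phases, \<open>\<phi> * (n + 1) * \<alpha>\<close> from the integrand and
  \<open>(pi - \<phi>) * (n + 1) * \<alpha>\<close> from the rotated Gamma integral, add up to a value independent of \<open>\<phi>\<close>, whose
  imaginary part is the sine of the series defining \<open>psi\<close>.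
\<close>

lemma h_conv_ray_integral:
  assumes \<alpha>: "0 < \<alpha>" "\<alpha> < 1" and \<theta>: "0 < \<theta>" and \<phi>: "pi / 2 < \<phi>" "\<phi> < pi"
  shows "h \<alpha> \<theta> = 1 / pi * Im (\<integral>r. ray_integrand \<alpha> \<phi> \<theta> r \<partial>lborel)"
proof -
  \<comment> \<open>the scale of the Gamma integrals; it has positive real part because \<open>\<phi> > pi / 2\<close>\<close>
  define w where "w = - cis \<phi>"
  have w_cis: "w = cis (\<phi> - pi)"
    by (simp add: w_def complex_eq_iff cos_diff sin_diff)
  have w: "0 < Re w"
    using \<phi> cos_gt_zero_pi[of "\<phi> - pi"] by (simp add: w_cis)
  define g where "g r = of_real (gamma_kernel \<alpha> r) * cis (\<phi> * \<alpha>) * exp (cis \<phi> * of_real r)" for r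
  define q where "q r = - (of_real \<theta> * (of_real (r powr \<alpha>) * cis (\<phi> * \<alpha>)))" for r
  have [measurable]: "g \<in> borel_measurable lborel" "q \<in> borel_measurable lborel"
    unfolding g_def q_def by measurable
  have ng: "norm (g r) * exp (norm (q r)) = gamma_kernel \<alpha> r * exp (- (Re w * r)) * exp (\<theta> * r powr \<alpha>)" for r
    using \<theta> by (simp add: g_def q_def norm_mult w_def)
  have "(\<lambda>n. \<integral>r. g r * (q r ^ n / fact n) \<partial>lborel) sums (\<integral>r. g r * exp (q r) \<partial>lborel)"
    by (rule exp_series_sums_integral)
      (unfold ng, use \<alpha> \<theta> w in \<open>auto intro!: integrable_gamma_kernel_exp_powr\<close>)
  also have "(\<lambda>r. g r * exp (q r)) = ray_integrand \<alpha> \<phi> \<theta>"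
    by (auto simp: g_def q_def ray_integrand_def)
  finally have "(\<lambda>n. Im (\<integral>r. g r * (q r ^ n / fact n) \<partial>lborel)) sums Im (\<integral>r. ray_integrand \<alpha> \<phi> \<theta> r \<partial>lborel)"
    by (rule sums_Im)
  also have "(\<lambda>n. Im (\<integral>r. g r * (q r ^ n / fact n) \<partial>lborel))
    = (\<lambda>n. (- \<theta>) ^ n / fact n * Gamma (Suc n * \<alpha>) * sin (Suc n * pi * \<alpha>))"
  proof
    fix n
    let ?x = "real (Suc n) * \<alpha>"
    have x: "?x > 0" using \<alpha> by simp
    have "g r * (q r ^ n / fact n)
      = ((- \<theta>) ^ n / fact n * cis (\<phi> * ?x)) * (of_real (gamma_kernel ?x r) * exp (- (w * of_real r)))" for r
    proof (cases "r > 0")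
      case True
      have K: "gamma_kernel \<alpha> r * (r powr \<alpha>) ^ n = gamma_kernel ?x r"
        using True by (simp add: powr_power gamma_kernel_add algebra_simps)
      have C: "cis (\<phi> * \<alpha>) * cis (\<phi> * \<alpha>) ^ n = cis (\<phi> * ?x)"
        by (simp add: Complex.DeMoivre cis_mult algebra_simps)
      have "q r = of_real (- \<theta>) * of_real (r powr \<alpha>) * cis (\<phi> * \<alpha>)"
        by (simp add: q_def)
      then have "q r ^ n = of_real ((- \<theta>) ^ n) * of_real ((r powr \<alpha>) ^ n) * cis (\<phi> * \<alpha>) ^ n"
        by (simp only: power_mult_distrib of_real_power)
      then have "g r * (q r ^ n / fact n)
        = of_real ((- \<theta>) ^ n) / fact n * (cis (\<phi> * \<alpha>) * cis (\<phi> * \<alpha>) ^ n)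
          * (of_real (gamma_kernel \<alpha> r * (r powr \<alpha>) ^ n) * exp (- (w * of_real r)))"
        by (simp add: g_def w_def)
      then show ?thesis
        unfolding K C by simp
    qed (simp add: g_def gamma_kernel_def)
    then have "(\<integral>r. g r * (q r ^ n / fact n) \<partial>lborel)
      = ((- \<theta>) ^ n / fact n * cis (\<phi> * ?x)) * (of_real (Gamma ?x) * w powr (- of_real ?x))"
      by (simp only: integral_mult_right_zero integral_Gamma_complex_scaled[OF x w])
    also have "w powr (- of_real ?x) = cis ((pi - \<phi>) * ?x)"
    proof -
      have "Ln w = (\<phi> - pi) * \<i>" "w \<noteq> 0"
        using \<phi> by (simp_all add: w_cis Ln_cis)
      moreover have "- of_real ?x * ((\<phi> - pi) * \<i>) = \<i> * of_real ((pi - \<phi>) * ?x)"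
        by (simp add: complex_eq_iff algebra_simps)
      ultimately show ?thesis
        by (simp only: powr_def cis_conv_exp if_False)
    qed
    also have "((- \<theta>) ^ n / fact n * cis (\<phi> * ?x)) * (of_real (Gamma ?x) * cis ((pi - \<phi>) * ?x))
      = of_real ((- \<theta>) ^ n / fact n * Gamma ?x) * cis (?x * pi)"
    proof -
      have "cis (\<phi> * ?x) * cis ((pi - \<phi>) * ?x) = cis (?x * pi)"
        by (simp add: cis_mult algebra_simps)
      then show ?thesis by (simp add: mult_ac)
    qed
    finally have I: "(\<integral>r. g r * (q r ^ n / fact n) \<partial>lborel)
      = of_real ((- \<theta>) ^ n / fact n * Gamma ?x) * cis (?x * pi)" .
    have Im_cis: "Im (of_real a * cis t) = a * sin t" for a t by simp
    have "?x * pi = Suc n * pi * \<alpha>" by (simp add: algebra_simps)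
    then show "Im (\<integral>r. g r * (q r ^ n / fact n) \<partial>lborel)
      = (- \<theta>) ^ n / fact n * Gamma ?x * sin (Suc n * pi * \<alpha>)"
      unfolding I Im_cis by (simp only:)
  qed
  finally have 1: "(\<lambda>n. (- \<theta>) ^ n / fact n * Gamma (Suc n * \<alpha>) * sin (Suc n * pi * \<alpha>))
     sums Im (\<integral>r. ray_integrand \<alpha> \<phi> \<theta> r \<partial>lborel)" .
  define s where "s = \<theta> powr (- (1 / \<alpha>))"
  define f where "f n = (- 1) ^ n * s powr (- (real (Suc n) * \<alpha>) - 1)
           * (Gamma (real (Suc n) * \<alpha> + 1) / fact (Suc n)) * sin (real (Suc n) * pi * \<alpha>)" for n
  have f: "f n = \<alpha> * \<theta> powr (1 + 1 / \<alpha>) * ((- \<theta>) ^ n / fact n * Gamma (Suc n * \<alpha>) * sin (Suc n * pi * \<alpha>))" for n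
  proof -
    let ?x = "real (Suc n) * \<alpha>"
    have "s powr (- ?x - 1) = \<theta> powr (real n + (1 + 1 / \<alpha>))"
      unfolding s_def powr_powr using \<alpha> by (intro arg_cong2[where f="(powr)"]) (auto simp: field_simps)
    also have "\<dots> = \<theta> ^ n * \<theta> powr (1 + 1 / \<alpha>)"
      using \<theta> by (subst powr_add) (simp add: powr_realpow)
    finally have s: "s powr (- ?x - 1) = \<theta> ^ n * \<theta> powr (1 + 1 / \<alpha>)" .
    have x: "?x > 0" using \<alpha> by simp
    then have "?x \<notin> \<int>\<^sub>\<le>\<^sub>0" by (metis nonpos_Ints_nonpos not_le)
    from Gamma_plus1[OF this] have "Gamma (?x + 1) / fact (Suc n) = (?x * Gamma ?x) / (real (Suc n) * fact n)"
      by (simp only: fact_Suc)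
    also have "\<dots> = \<alpha> * Gamma ?x / fact n"
      by (simp del: of_nat_Suc)
    finally have G: "Gamma (?x + 1) / fact (Suc n) = \<alpha> * Gamma ?x / fact n" .
    show ?thesis
      unfolding f_def s G by (subst power_minus) (simp add: mult_ac)
  qed
  have "f sums (\<alpha> * \<theta> powr (1 + 1 / \<alpha>) * Im (\<integral>r. ray_integrand \<alpha> \<phi> \<theta> r \<partial>lborel))"
    unfolding f by (rule sums_mult[OF 1])
  then have "psi \<alpha> s = 1 / pi * (\<alpha> * \<theta> powr (1 + 1 / \<alpha>) * Im (\<integral>r. ray_integrand \<alpha> \<phi> \<theta> r \<partial>lborel))"
    unfolding psi_def f_def[symmetric] by (simp add: sums_iff)
  moreover have "\<theta> powr (- 1 - 1 / \<alpha>) * \<theta> powr (1 + 1 / \<alpha>) = 1"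
    using \<theta> by (simp flip: powr_add)
  moreover have "1 / \<alpha> * A * (1 / pi * (\<alpha> * B * I)) = (A * B) * (1 / pi * I)" for A B I :: real
    using \<alpha> by simp
  ultimately show ?thesis
    unfolding h_def s_def[symmetric] by simp
qed

section \<open>Averages of the density against a tent function\<close>

definition tent :: "real \<Rightarrow> real" where
  "tent \<theta> = max 0 (1 / 2 - \<bar>\<theta> - 1\<bar>)"

lemma tent_measurable [measurable]: "tent \<in> borel_measurable borel"
  unfolding tent_def[abs_def] by measurable

lemma tent_bounds: "0 \<le> tent \<theta>" "tent \<theta> \<le> indicator {1/2..3/2} \<theta>"
  by (auto simp: tent_def indicator_def)

definition tent_laplace :: "complex \<Rightarrow> complex" where
  "tent_laplace q = (\<integral>\<theta>. of_real (tent \<theta>) * exp (- (of_real \<theta> * q)) \<partial>lborel)"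

lemma tent_laplace_eq:
  assumes "q \<noteq> 0"
  shows "tent_laplace q = (exp (- (q / 2)) - 2 * exp (- q) + exp (- (3 / 2 * q))) / q\<^sup>2"
proof -
  define f1 where "f1 \<theta> = (of_real \<theta> - 1 / 2) * exp (- (of_real \<theta> * q))" for \<theta> :: real
  define F1 where "F1 \<theta> = - (((of_real \<theta> - 1 / 2) / q + 1 / q\<^sup>2) * exp (- (of_real \<theta> * q)))" for \<theta> :: real
  define f2 where "f2 \<theta> = (3 / 2 - of_real \<theta>) * exp (- (of_real \<theta> * q))" for \<theta> :: real
  define F2 where "F2 \<theta> = - (((3 / 2 - of_real \<theta>) / q - 1 / q\<^sup>2) * exp (- (of_real \<theta> * q)))" for \<theta> :: real
  have "((\<lambda>z. - (((z - 1 / 2) / q + 1 / q\<^sup>2) * exp (- (z * q)))) has_field_derivative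
      (z - 1 / 2) * exp (- (z * q))) (at z)" for z
    using assms by (auto intro!: derivative_eq_intros simp: field_simps power2_eq_square)
  from has_vector_derivative_real_field[OF this]
  have D1: "(F1 has_vector_derivative f1 \<theta>) (at \<theta> within S)" for \<theta> S
    unfolding F1_def f1_def .
  have "((\<lambda>z. - (((3 / 2 - z) / q - 1 / q\<^sup>2) * exp (- (z * q)))) has_field_derivative
      (3 / 2 - z) * exp (- (z * q))) (at z)" for z
    using assms by (auto intro!: derivative_eq_intros simp: field_simps power2_eq_square)
  from has_vector_derivative_real_field[OF this]
  have D2: "(F2 has_vector_derivative f2 \<theta>) (at \<theta> within S)" for \<theta> S
    unfolding F2_def f2_def .
  have "has_bochner_integral lborel (\<lambda>\<theta>. indicator {1/2..1} \<theta> *\<^sub>R f1 \<theta>) (F1 1 - F1 (1/2))"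
    by (rule has_bochner_integral_FTC_Icc[OF _ D1]) (auto simp: f1_def intro!: continuous_intros)
  moreover have "has_bochner_integral lborel (\<lambda>\<theta>. indicator {1..3/2} \<theta> *\<^sub>R f2 \<theta>) (F2 (3/2) - F2 1)"
    by (rule has_bochner_integral_FTC_Icc[OF _ D2]) (auto simp: f2_def intro!: continuous_intros)
  ultimately have "has_bochner_integral lborel
      (\<lambda>\<theta>. indicator {1/2..1} \<theta> *\<^sub>R f1 \<theta> + indicator {1..3/2} \<theta> *\<^sub>R f2 \<theta>)
      ((F1 1 - F1 (1/2)) + (F2 (3/2) - F2 1))"
    by (rule has_bochner_integral_add)
  then have "(\<integral>\<theta>. indicator {1/2..1} \<theta> *\<^sub>R f1 \<theta> + indicator {1..3/2} \<theta> *\<^sub>R f2 \<theta> \<partial>lborel)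
    = (F1 1 - F1 (1/2)) + (F2 (3/2) - F2 1)"
    by (rule has_bochner_integral_integral_eq)
  also have "(\<integral>\<theta>. indicator {1/2..1} \<theta> *\<^sub>R f1 \<theta> + indicator {1..3/2} \<theta> *\<^sub>R f2 \<theta> \<partial>lborel) = tent_laplace q"
    unfolding tent_laplace_def
  proof (rule integral_cong_AE)
    show "AE \<theta> in lborel. indicator {1/2..1} \<theta> *\<^sub>R f1 \<theta> + indicator {1..3/2} \<theta> *\<^sub>R f2 \<theta>
      = of_real (tent \<theta>) * exp (- (of_real \<theta> * q))"
      using AE_lborel_singleton[of "1::real"]
      by eventually_elim (auto simp: f1_def f2_def tent_def indicator_def max_def abs_if)
  qed (auto simp: f1_def f2_def)
  also have "(F1 1 - F1 (1/2)) + (F2 (3/2) - F2 1)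
    = (exp (- (q / 2)) - 2 * exp (- q) + exp (- (3 / 2 * q))) / q\<^sup>2"
    using assms by (simp add: F1_def F2_def field_simps)
  finally show ?thesis by simp
qed

text \<open>
  Being Lipschitz with compact support, the tent has a transform of size \<open>1 / (norm q)\<^sup>2\<close> up to the
  boundary of the right half-plane.  This decay is what makes the integrals below converge uniformly in \<open>\<alpha>\<close>.
\<close>

lemma norm_tent_laplace_le:
  assumes "0 \<le> Re q"
  shows "norm (tent_laplace q) \<le> 1" "q \<noteq> 0 \<Longrightarrow> norm (tent_laplace q) \<le> 4 / (norm q)\<^sup>2"
proof -
  have "norm (tent_laplace q) \<le> (\<integral>\<theta>. indicator {1/2..3/2::real} \<theta> \<partial>lborel)"
    unfolding tent_laplace_def
  proof (rule Bochner_Integration.integral_norm_bound_integral)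
    have "norm (of_real (tent \<theta>) * exp (- (of_real \<theta> * q))) \<le> indicator {1/2..3/2} \<theta>" for \<theta>
    proof (cases "0 \<le> \<theta>")
      case True
      then have "exp (- (\<theta> * Re q)) \<le> 1" using assms by simp
      then have "tent \<theta> * exp (- (\<theta> * Re q)) \<le> tent \<theta> * 1"
        using tent_bounds by (intro mult_left_mono) auto
      then show ?thesis using tent_bounds[of \<theta>] by (simp add: norm_mult)
    qed (simp add: tent_def)
    then show "\<And>\<theta>. norm (of_real (tent \<theta>) * exp (- (of_real \<theta> * q))) \<le> indicator {1/2..3/2} \<theta>" .
    show int: "integrable lborel (indicator {1/2..3/2} :: real \<Rightarrow> real)" by simp
    show "integrable lborel (\<lambda>\<theta>. of_real (tent \<theta>) * exp (- (of_real \<theta> * q)))"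
      by (rule Bochner_Integration.integrable_bound[OF int])
        (use \<open>\<And>\<theta>. norm (of_real (tent \<theta>) * exp (- (of_real \<theta> * q))) \<le> indicator {1/2..3/2} \<theta>\<close> in auto)
  qed
  then show "norm (tent_laplace q) \<le> 1" by simp
  assume q: "q \<noteq> 0"
  have e: "norm (exp (- (of_real c * q))) \<le> 1" if "0 \<le> c" for c
    using assms that by simp
  have "norm (exp (- (q / 2)) - 2 * exp (- q) + exp (- (3 / 2 * q)))
    \<le> norm (exp (- (q / 2))) + norm (2 * exp (- q)) + norm (exp (- (3 / 2 * q)))"
    by (intro norm_triangle_le norm_triangle_le_diff add_mono) auto
  also have "\<dots> \<le> 1 + 2 * 1 + 1"
    using e[of "1/2"] e[of 1] e[of "3/2"] unfolding norm_mult by (intro add_mono mult_mono) auto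
  finally show "norm (tent_laplace q) \<le> 4 / (norm q)\<^sup>2"
    unfolding tent_laplace_eq[OF q] norm_divide norm_power by (intro divide_right_mono) auto
qed

lemma tent_laplace_measurable [measurable]: "tent_laplace \<in> borel_measurable borel"
  unfolding tent_laplace_def[abs_def] by measurable

text \<open>
  Fubini's theorem applied to the ray representation.  The condition \<open>\<phi> * \<alpha> \<le> pi / 2\<close> keeps
  \<open>exp (- \<theta> * r powr \<alpha> * cis (\<phi> * \<alpha>))\<close> bounded, while \<open>\<phi> > pi / 2\<close> keeps \<open>exp (r * cis \<phi>)\<close> integrable; both are
  possible at once because \<open>\<alpha> < 1\<close>.
\<close>

lemma integral_tent_h:
  assumes \<alpha>: "0 < \<alpha>" "\<alpha> < 1" and \<phi>: "pi / 2 < \<phi>" "\<phi> < pi" "\<phi> * \<alpha> \<le> pi / 2"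
  shows "integrable lborel (\<lambda>\<theta>. tent \<theta> * h \<alpha> \<theta>)"
    and "(\<integral>\<theta>. tent \<theta> * h \<alpha> \<theta> \<partial>lborel) = 1 / pi * Im (\<integral>r. of_real (gamma_kernel \<alpha> r) * cis (\<phi> * \<alpha>)
      * exp (cis \<phi> * of_real r) * tent_laplace (of_real (r powr \<alpha>) * cis (\<phi> * \<alpha>)) \<partial>lborel)"
proof -
  define F where "F \<theta> r = of_real (tent \<theta>) * ray_integrand \<alpha> \<phi> \<theta> r" for \<theta> r
  define B where "B \<theta> r = indicator {1/2..3/2} \<theta> * (gamma_kernel \<alpha> r * exp (- (- cos \<phi> * r)))" for \<theta> r :: real
  have c: "- cos \<phi> > 0"
    using \<phi> cos_gt_zero_pi[of "\<phi> - pi"] by (simp add: cos_diff)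
  have c': "cos (\<phi> * \<alpha>) \<ge> 0"
  proof (rule cos_ge_zero)
    show "- (pi / 2) \<le> \<phi> * \<alpha>" using \<alpha> \<phi> pi_gt_zero by (auto intro: order_trans[of _ 0])
  qed (use \<phi> in auto)
  have FB: "norm (F \<theta> r) \<le> norm (B \<theta> r)" for \<theta> r
  proof -
    have "tent \<theta> * exp (- (\<theta> * (r powr \<alpha> * cos (\<phi> * \<alpha>)))) \<le> indicator {1/2..3/2} \<theta>"
    proof (cases "0 \<le> \<theta>")
      case True
      then have "exp (- (\<theta> * (r powr \<alpha> * cos (\<phi> * \<alpha>)))) \<le> 1" using c' by simp
      then have "tent \<theta> * exp (- (\<theta> * (r powr \<alpha> * cos (\<phi> * \<alpha>)))) \<le> tent \<theta> * 1"
        using tent_bounds by (intro mult_left_mono) auto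
      then show ?thesis using tent_bounds[of \<theta>] by simp
    qed (simp add: tent_def)
    then have "(tent \<theta> * exp (- (\<theta> * (r powr \<alpha> * cos (\<phi> * \<alpha>))))) * (gamma_kernel \<alpha> r * exp (cos \<phi> * r))
      \<le> indicator {1/2..3/2} \<theta> * (gamma_kernel \<alpha> r * exp (cos \<phi> * r))"
      by (intro mult_right_mono) auto
    then show ?thesis
      using tent_bounds[of \<theta>] by (simp add: F_def B_def ray_integrand_def norm_mult abs_mult mult_ac)
  qed
  have k: "integrable lborel (\<lambda>r. gamma_kernel \<alpha> r * exp (- (- cos \<phi> * r)))"
    using \<alpha> c by (rule_tac integrable_gamma_kernel)
  have "integrable (lborel \<Otimes>\<^sub>M lborel) (case_prod B)"
  proof (rule lborel_pair.Fubini_integrable)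
    have "(\<lambda>\<theta>. \<integral>r. norm (case_prod B (\<theta>, r)) \<partial>lborel)
      = (\<lambda>\<theta>. indicator {1/2..3/2} \<theta> * (\<integral>r. gamma_kernel \<alpha> r * exp (- (- cos \<phi> * r)) \<partial>lborel))"
      by (simp add: B_def abs_mult)
    then show "integrable lborel (\<lambda>\<theta>. \<integral>r. norm (case_prod B (\<theta>, r)) \<partial>lborel)"
      by simp
    show "AE \<theta> in lborel. integrable lborel (\<lambda>r. case_prod B (\<theta>, r))"
      using k by (simp add: B_def)
  next
    show "case_prod B \<in> borel_measurable (lborel \<Otimes>\<^sub>M lborel)"
      unfolding B_def by measurable
  qed
  moreover have "case_prod F \<in> borel_measurable (lborel \<Otimes>\<^sub>M lborel)"
    unfolding F_def ray_integrand_def by measurable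
  ultimately have intF: "integrable (lborel \<Otimes>\<^sub>M lborel) (case_prod F)"
    by (rule Bochner_Integration.integrable_bound) (use FB in auto)
  have eq: "tent \<theta> * h \<alpha> \<theta> = 1 / pi * Im (\<integral>r. F \<theta> r \<partial>lborel)" for \<theta>
  proof (cases "0 < \<theta>")
    case True
    then show ?thesis
      using h_conv_ray_integral[OF \<alpha> True \<phi>(1,2)] by (simp add: F_def)
  qed (simp add: F_def tent_def)
  have int1: "integrable lborel (\<lambda>\<theta>. \<integral>r. F \<theta> r \<partial>lborel)"
    using lborel_pair.integrable_fst[OF intF] .
  show "integrable lborel (\<lambda>\<theta>. tent \<theta> * h \<alpha> \<theta>)"
    unfolding eq using int1 by auto
  have "(\<integral>\<theta>. tent \<theta> * h \<alpha> \<theta> \<partial>lborel) = 1 / pi * Im (\<integral>\<theta>. (\<integral>r. F \<theta> r \<partial>lborel) \<partial>lborel)"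
    unfolding eq using int1 by simp
  also have "(\<integral>\<theta>. (\<integral>r. F \<theta> r \<partial>lborel) \<partial>lborel) = (\<integral>r. (\<integral>\<theta>. F \<theta> r \<partial>lborel) \<partial>lborel)"
    using lborel_pair.Fubini_integral[OF intF] by simp
  also have "(\<lambda>r. \<integral>\<theta>. F \<theta> r \<partial>lborel) = (\<lambda>r. of_real (gamma_kernel \<alpha> r) * cis (\<phi> * \<alpha>)
      * exp (cis \<phi> * of_real r) * tent_laplace (of_real (r powr \<alpha>) * cis (\<phi> * \<alpha>)))"
    unfolding F_def ray_integrand_def tent_laplace_def
    by (subst integral_mult_right_zero[symmetric]) (simp add: mult_ac)
  finally show "(\<integral>\<theta>. tent \<theta> * h \<alpha> \<theta> \<partial>lborel) = 1 / pi * Im (\<integral>r. of_real (gamma_kernel \<alpha> r) * cis (\<phi> * \<alpha>)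
      * exp (cis \<phi> * of_real r) * tent_laplace (of_real (r powr \<alpha>) * cis (\<phi> * \<alpha>)) \<partial>lborel)" .
qed

section \<open>Concentration of the density as the order tends to one\<close>

text \<open>
  An angle admissible for \<open>integral_tent_h\<close> which tends to \<open>pi / 2\<close> as \<open>\<alpha>\<close> tends to \<open>1\<close>.
\<close>

definition ray_angle :: "real \<Rightarrow> real" where
  "ray_angle \<alpha> = pi / 2 + (1 - \<alpha>)"

lemma ray_angle:
  assumes "1 / 2 < \<alpha>" "\<alpha> < 1"
  shows "pi / 2 < ray_angle \<alpha>" "ray_angle \<alpha> < pi" "ray_angle \<alpha> * \<alpha> \<le> pi / 2"
proof -
  show "pi / 2 < ray_angle \<alpha>" "ray_angle \<alpha> < pi"
    using assms pi_ge_two by (auto simp: ray_angle_def)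
  have "ray_angle \<alpha> * \<alpha> = pi / 2 - (1 - \<alpha>) * (pi / 2 - \<alpha>)"
    by (simp add: ray_angle_def field_simps)
  also have "\<dots> \<le> pi / 2"
    using assms pi_ge_two by simp
  finally show "ray_angle \<alpha> * \<alpha> \<le> pi / 2" .
qed

definition ray_tent :: "real \<Rightarrow> real \<Rightarrow> complex" where
  "ray_tent \<alpha> r = of_real (gamma_kernel \<alpha> r) * cis (ray_angle \<alpha> * \<alpha>)
      * exp (cis (ray_angle \<alpha>) * of_real r) * tent_laplace (of_real (r powr \<alpha>) * cis (ray_angle \<alpha> * \<alpha>))"

text \<open>
  A common majorant for \<open>\<alpha> > 1 / 2\<close>: near \<open>0\<close> it comes from \<open>r powr (\<alpha> - 1)\<close>, near infinity from
  \<open>r powr (\<alpha> - 1) * 4 / (r powr \<alpha>)\<^sup>2\<close>.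
\<close>

definition ray_bound :: "real \<Rightarrow> real" where
  "ray_bound r = indicator {0<..1} r * r powr (- 1 / 2) + 4 * (indicator {1..} r * r powr (- 3 / 2))"

lemma integrable_ray_bound: "integrable lborel ray_bound"
proof -
  have "integrable lborel (\<lambda>r. exp 1 * (gamma_kernel (1 / 2) r * exp (- (1 * r))))"
    by (intro integrable_mult_right integrable_gamma_kernel) auto
  then have 1: "integrable lborel (\<lambda>r::real. indicator {0<..1} r * r powr (- 1 / 2))"
  proof (rule Bochner_Integration.integrable_bound)
    have "norm (indicator {0<..1} r * r powr (- 1 / 2)) \<le> norm (exp 1 * (gamma_kernel (1 / 2) r * exp (- (1 * r))))" for r :: real
    proof (cases "r \<in> {0<..1}")
      case True
      then have "1 * r powr (- 1 / 2) \<le> exp (1 - r) * r powr (- 1 / 2)"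
        by (intro mult_right_mono) auto
      moreover have "exp (1 - r) = exp 1 * exp (- r)"
        by (simp flip: exp_add)
      ultimately show ?thesis
        using True by (simp add: gamma_kernel_def abs_mult mult.left_commute mult.commute)
    qed simp
    then show "AE r::real in lborel. norm (indicator {0<..1} r * r powr (- 1 / 2))
       \<le> norm (exp 1 * (gamma_kernel (1 / 2) r * exp (- (1 * r))))"
      by simp
  qed measurable
  have "(\<lambda>r::real. r powr (- 3 / 2)) absolutely_integrable_on {1..}"
    using has_integral_powr_to_inf[of "- 3 / 2" 1]
    by (intro nonnegative_absolutely_integrable_1) (auto simp: integrable_on_def)
  then have "integrable lebesgue (\<lambda>r::real. indicator {1..} r * r powr (- 3 / 2))"
    by (simp add: set_integrable_def)
  then have 2: "integrable lborel (\<lambda>r::real. indicator {1..} r * r powr (- 3 / 2))"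
    by (subst (asm) integrable_completion) auto
  show ?thesis
    unfolding ray_bound_def[abs_def] using 1 2 by simp
qed

lemma norm_ray_tent_le:
  assumes "1 / 2 < \<alpha>" "\<alpha> < 1"
  shows "norm (ray_tent \<alpha> r) \<le> ray_bound r"
proof (cases "0 < r")
  case True
  define q where "q = of_real (r powr \<alpha>) * cis (ray_angle \<alpha> * \<alpha>)"
  have "- (pi / 2) \<le> ray_angle \<alpha> * \<alpha>"
    using assms ray_angle[OF assms] pi_gt_zero by (auto intro: order_trans[of _ 0])
  then have Req: "0 \<le> Re q"
    using ray_angle[OF assms] by (auto simp: q_def intro!: mult_nonneg_nonneg cos_ge_zero)
  have q0: "q \<noteq> 0" using True by (simp add: q_def)
  have nq: "norm q = r powr \<alpha>" by (simp add: q_def norm_mult)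
  have "cos (ray_angle \<alpha>) \<le> 0"
    using assms pi_ge_two by (simp add: ray_angle_def cos_add sin_ge_zero)
  then have e1: "exp (cos (ray_angle \<alpha>) * r) \<le> 1"
    using True by (simp add: mult_nonpos_nonneg)
  have n: "norm (ray_tent \<alpha> r) = r powr (\<alpha> - 1) * norm (tent_laplace q) * exp (cos (ray_angle \<alpha>) * r)"
    using True by (simp add: ray_tent_def q_def norm_mult gamma_kernel_def)
  also have "\<dots> \<le> r powr (\<alpha> - 1) * norm (tent_laplace q)"
    using mult_left_mono[OF e1, of "r powr (\<alpha> - 1) * norm (tent_laplace q)"] by simp
  also have "\<dots> \<le> ray_bound r"
  proof (cases "r \<le> 1")
    case r: True
    have "r powr (\<alpha> - 1) * norm (tent_laplace q) \<le> r powr (\<alpha> - 1)"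
      using norm_tent_laplace_le(1)[OF Req] by (intro mult_left_le) auto
    also have "\<dots> \<le> r powr (- 1 / 2)"
      using True r assms by (intro powr_mono') auto
    also have "\<dots> \<le> ray_bound r"
      using True r by (simp add: ray_bound_def)
    finally show ?thesis .
  next
    case r: False
    have "r powr (\<alpha> - 1) * norm (tent_laplace q) \<le> r powr (\<alpha> - 1) * (4 / (norm q)\<^sup>2)"
      using norm_tent_laplace_le(2)[OF Req q0] by (intro mult_left_mono) auto
    also have "\<dots> = 4 * (r powr (\<alpha> - 1) / r powr (2 * \<alpha>))"
      using True unfolding nq by (simp add: powr_power mult.commute)
    also have "\<dots> = 4 * r powr (- \<alpha> - 1)"
      by (simp flip: powr_diff)
    also have "\<dots> \<le> 4 * r powr (- 3 / 2)"
      using r assms by (intro mult_left_mono powr_mono) auto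
    also have "\<dots> = ray_bound r"
      using r by (simp add: ray_bound_def)
    finally show ?thesis .
  qed
  finally show ?thesis .
qed (auto simp: ray_tent_def gamma_kernel_def ray_bound_def)

text \<open>
  The Fejer kernel, multiplied by \<open>\<i>\<close> because it appears as the limit of complex integrands.
\<close>

definition fejer :: "real \<Rightarrow> complex" where
  "fejer r = of_real (indicator {0<..} r * ((2 - 2 * cos (r / 2)) / r\<^sup>2)) * \<i>"

text \<open>
  At \<open>\<alpha> = 1\<close> and \<open>\<phi> = pi / 2\<close> the exponentials of \<open>tent_laplace\<close>, shifted by \<open>exp (\<i> * r)\<close>, become
  \<open>exp (\<i> * r / 2) - 2 + exp (- \<i> * r / 2)\<close>, the second difference centred at the tip of the tent.
\<close>

lemma ray_tent_tendsto: "((\<lambda>\<alpha>. ray_tent \<alpha> r) \<longlongrightarrow> fejer r) (at_left 1)"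
proof (cases "0 < r")
  case True
  define E where "E q = (exp (- (q / 2)) - 2 * exp (- q) + exp (- (3 / 2 * q))) / q\<^sup>2" for q :: complex
  define q where "q \<alpha> = of_real (r powr \<alpha>) * cis (ray_angle \<alpha> * \<alpha>)" for \<alpha>
  have eq: "ray_tent \<alpha> r = of_real (r powr (\<alpha> - 1)) * cis (ray_angle \<alpha> * \<alpha>)
      * exp (cis (ray_angle \<alpha>) * of_real r) * E (q \<alpha>)" for \<alpha>
  proof -
    have "q \<alpha> \<noteq> 0" using True by (simp add: q_def)
    from tent_laplace_eq[OF this] show ?thesis
      using True by (simp add: ray_tent_def q_def gamma_kernel_def E_def)
  qed
  have A: "(ray_angle \<longlongrightarrow> pi / 2) (at_left 1)"
    unfolding ray_angle_def by (auto intro!: tendsto_eq_intros)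
  have cis_lim: "((\<lambda>\<alpha>. cis (f \<alpha>)) \<longlongrightarrow> cis l) F" if "(f \<longlongrightarrow> l) F" for f :: "real \<Rightarrow> real" and l F
    unfolding cis_conv_exp by (intro tendsto_intros that)
  have c1: "((\<lambda>\<alpha>. cis (ray_angle \<alpha>)) \<longlongrightarrow> \<i>) (at_left 1)"
    using cis_lim[OF A] by simp
  have "((\<lambda>\<alpha>. ray_angle \<alpha> * \<alpha>) \<longlongrightarrow> pi / 2 * 1) (at_left 1)"
    by (intro tendsto_mult A tendsto_ident_at)
  from cis_lim[OF this] have c2: "((\<lambda>\<alpha>. cis (ray_angle \<alpha> * \<alpha>)) \<longlongrightarrow> \<i>) (at_left 1)"
    by simp
  have "((\<lambda>\<alpha>. of_real (r powr \<alpha>) * cis (ray_angle \<alpha> * \<alpha>)) \<longlongrightarrow> of_real (r powr 1) * \<i>) (at_left 1)"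
    using True by (intro tendsto_intros c2) auto
  then have ql: "(q \<longlongrightarrow> of_real r * \<i>) (at_left 1)"
    using True by (simp add: q_def[abs_def])
  have El: "((\<lambda>\<alpha>. E (q \<alpha>)) \<longlongrightarrow> E (of_real r * \<i>)) (at_left 1)"
    unfolding E_def using True by (intro tendsto_intros ql) auto
  have "((\<lambda>\<alpha>. ray_tent \<alpha> r) \<longlongrightarrow>
      of_real (r powr (1 - 1)) * \<i> * exp (\<i> * of_real r) * E (of_real r * \<i>)) (at_left 1)"
    unfolding eq using True by (intro tendsto_intros c1 c2 El) auto
  also have "of_real (r powr (1 - 1)) * \<i> * exp (\<i> * of_real r) * E (of_real r * \<i>) = fejer r"
  proof -
    have "exp (\<i> * of_real r) * (exp (- (of_real r * \<i> / 2)) - 2 * exp (- (of_real r * \<i>)) + exp (- (3 / 2 * (of_real r * \<i>))))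
      = exp (\<i> * of_real (r / 2)) - 2 + exp (\<i> * of_real (- (r / 2)))"
      by (simp add: algebra_simps flip: exp_add)
    also have "\<dots> = of_real (2 * cos (r / 2) - 2)"
      unfolding cis_conv_exp[symmetric] by (simp add: complex_eq_iff)
    finally have "exp (\<i> * of_real r) * E (of_real r * \<i>) = of_real (2 * cos (r / 2) - 2) / (of_real r * \<i>)\<^sup>2"
      unfolding E_def by simp
    also have "\<dots> = of_real ((2 - 2 * cos (r / 2)) / r\<^sup>2)"
      using True by (simp add: power_mult_distrib field_simps)
    finally show ?thesis
      using True by (simp add: fejer_def mult.assoc)
  qed
  finally show ?thesis .
qed (simp add: ray_tent_def gamma_kernel_def fejer_def)

text \<open>
  Dominated convergence, with \<open>ray_angle \<alpha>\<close> as the angle of the ray for each \<open>\<alpha>\<close>.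
\<close>

lemma integral_tent_h_tendsto:
  "((\<lambda>\<alpha>. \<integral>\<theta>. tent \<theta> * h \<alpha> \<theta> \<partial>lborel) \<longlongrightarrow> 1 / pi * Im (\<integral>r. fejer r \<partial>lborel)) (at_left 1)"
  and integrable_fejer: "integrable lborel fejer"
proof -
  have m: "fejer \<in> borel_measurable lborel" "ray_tent \<alpha> \<in> borel_measurable lborel" for \<alpha>
    unfolding fejer_def[abs_def] ray_tent_def[abs_def] by measurable
  have lim: "(\<lambda>n. ray_tent (S n) r) \<longlonglongrightarrow> fejer r"
    if "\<And>n. S n < 1" "S \<longlonglongrightarrow> 1" for S r
    using filterlim_compose[OF ray_tent_tendsto[of r], of S sequentially] that
    by (simp add: filterlim_at less_imp_neq)
  \<comment> \<open>any sequence in \<open>(1/2, 1)\<close> tending to \<open>1\<close> shows that the limit function is integrable\<close>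
  have "(\<lambda>n. 1 + - inverse (real (Suc (n + 2)))) \<longlonglongrightarrow> 1" 
    using LIMSEQ_ignore_initial_segment[OF LIMSEQ_inverse_real_of_nat_add_minus[of 1], of 2] .
  show "integrable lborel fejer"
  proof (rule integrable_dominated_convergence[where w=ray_bound and s="\<lambda>n. ray_tent (1 + - inverse (real (Suc (n + 2))))"])
    show "AE r in lborel. (\<lambda>n. ray_tent (1 + - inverse (real (Suc (n + 2)))) r) \<longlonglongrightarrow> fejer r"
      by (intro AE_I2 lim \<open>_ \<longlonglongrightarrow> 1\<close>) simp
    show "AE r in lborel. norm (ray_tent (1 + - inverse (real (Suc (n + 2)))) r) \<le> ray_bound r" for n
      by (intro AE_I2 norm_ray_tent_le) (auto simp: field_simps)
  qed (use m integrable_ray_bound in auto)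
  show "((\<lambda>\<alpha>. \<integral>\<theta>. tent \<theta> * h \<alpha> \<theta> \<partial>lborel) \<longlongrightarrow> 1 / pi * Im (\<integral>r. fejer r \<partial>lborel)) (at_left 1)"
  proof (rule tendsto_at_left_sequentially[of "1/2"])
    fix S :: "nat \<Rightarrow> real"
    assume S: "\<And>n. S n < 1" "\<And>n. 1 / 2 < S n" "S \<longlonglongrightarrow> 1"
    have "(\<lambda>n. \<integral>r. ray_tent (S n) r \<partial>lborel) \<longlonglongrightarrow> (\<integral>r. fejer r \<partial>lborel)"
    proof (rule integral_dominated_convergence[where w=ray_bound])
      show "AE r in lborel. (\<lambda>n. ray_tent (S n) r) \<longlonglongrightarrow> fejer r"
        by (intro AE_I2 lim S)
      show "AE r in lborel. norm (ray_tent (S n) r) \<le> ray_bound r" for n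
        by (intro AE_I2 norm_ray_tent_le S)
    qed (use m integrable_ray_bound in auto)
    then have "(\<lambda>n. 1 / pi * Im (\<integral>r. ray_tent (S n) r \<partial>lborel)) \<longlonglongrightarrow> 1 / pi * Im (\<integral>r. fejer r \<partial>lborel)"
      by (intro tendsto_intros)
    moreover have "(\<integral>\<theta>. tent \<theta> * h (S n) \<theta> \<partial>lborel) = 1 / pi * Im (\<integral>r. ray_tent (S n) r \<partial>lborel)" for n
    proof -
      have "0 < S n" using S(2)[of n] by linarith
      then show ?thesis
        unfolding ray_tent_def by (intro integral_tent_h ray_angle S)
    qed
    ultimately show "(\<lambda>n. \<integral>\<theta>. tent \<theta> * h (S n) \<theta> \<partial>lborel) \<longlonglongrightarrow> 1 / pi * Im (\<integral>r. fejer r \<partial>lborel)"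
      by simp
  qed simp
qed

lemma Im_integral_fejer_pos: "0 < Im (\<integral>r. fejer r \<partial>lborel)"
proof -
  define c :: real where "c = (2 - 2 * cos (1 / 2)) / 4"
  have "cos (1 / 2) < cos (0::real)"
    by (rule cos_monotone_0_pi) (use pi_ge_two in auto)
  then have "0 < c" by (simp add: c_def)
  also have "c = (\<integral>r. c * indicator {1..2::real} r \<partial>lborel)" by simp
  also have "\<dots> \<le> (\<integral>r. Im (fejer r) \<partial>lborel)"
  proof (rule integral_mono)
    show "integrable lborel (\<lambda>r. Im (fejer r))"
      using integrable_fejer by (rule integrable_Im)
    fix r :: real
    show "c * indicator {1..2} r \<le> Im (fejer r)"
    proof (cases "r \<in> {1..2}")
      case True
      have "cos (r / 2) \<le> cos (1 / 2)"
        by (rule cos_monotone_0_pi_le) (use True pi_ge_two in auto)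
      moreover have "r\<^sup>2 \<le> 2\<^sup>2" using True by (intro power_mono) auto
      ultimately have "(2 - 2 * cos (1 / 2)) / 4 \<le> (2 - 2 * cos (r / 2)) / r\<^sup>2"
        using True by (intro frac_le) auto
      then show ?thesis using True by (simp add: fejer_def c_def)
    qed (auto simp: fejer_def indicator_def)
  qed simp
  also have "\<dots> = Im (\<integral>r. fejer r \<partial>lborel)"
    using integrable_fejer by simp
  finally show ?thesis .
qed

text \<open>
  The tent is at most the indicator of \<open>[1/2, 3/2]\<close>, so its average against \<open>h \<alpha>\<close> is at most the integral
  of the positive part of \<open>h \<alpha>\<close> there, and \<open>ennreal\<close> cuts off exactly the negative part.
\<close>

lemma nn_integral_h_near_1_lower_bound:
  "\<exists>\<eta>>0. \<forall>\<^sub>F \<alpha> in at_left 1. ennreal \<eta> \<le> (\<integral>\<^sup>+ \<theta>\<in>{1/2..3/2}. ennreal (h \<alpha> \<theta>) \<partial>lebesgue)"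
proof -
  define J where "J = 1 / pi * Im (\<integral>r. fejer r \<partial>lborel)"
  have J: "0 < J" using Im_integral_fejer_pos by (simp add: J_def)
  have "\<forall>\<^sub>F \<alpha> in at_left 1. J / 2 < (\<integral>\<theta>. tent \<theta> * h \<alpha> \<theta> \<partial>lborel)"
    using order_tendstoD(1)[OF integral_tent_h_tendsto, of "J / 2"] J unfolding J_def[symmetric] by simp
  moreover have "\<forall>\<^sub>F \<alpha> in at_left 1. \<alpha> \<in> {1/2<..<(1::real)}"
    by (rule eventually_at_left_real) simp
  ultimately have "\<forall>\<^sub>F \<alpha> in at_left 1. ennreal (J / 2) \<le> (\<integral>\<^sup>+ \<theta>\<in>{1/2..3/2}. ennreal (h \<alpha> \<theta>) \<partial>lebesgue)"
  proof eventually_elim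
    case (elim \<alpha>)
    then have \<alpha>: "1 / 2 < \<alpha>" "\<alpha> < 1" and \<alpha>0: "0 < \<alpha>" by auto
    have int: "integrable lborel (\<lambda>\<theta>. tent \<theta> * h \<alpha> \<theta>)"
      by (rule integral_tent_h(1)[OF \<alpha>0 \<alpha>(2) ray_angle[OF \<alpha>]])
    have "J / 2 \<le> enn2real (\<integral>\<^sup>+ \<theta>. ennreal (tent \<theta> * h \<alpha> \<theta>) \<partial>lborel)"
      using elim real_lebesgue_integral_def[OF int]
        enn2real_nonneg[of "\<integral>\<^sup>+ \<theta>. ennreal (- (tent \<theta> * h \<alpha> \<theta>)) \<partial>lborel"] by linarith
    then have "ennreal (J / 2) \<le> ennreal (enn2real (\<integral>\<^sup>+ \<theta>. ennreal (tent \<theta> * h \<alpha> \<theta>) \<partial>lborel))"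
      by (rule ennreal_leI)
    also have "\<dots> \<le> (\<integral>\<^sup>+ \<theta>. ennreal (tent \<theta> * h \<alpha> \<theta>) \<partial>lborel)"
      by (cases "(\<integral>\<^sup>+ \<theta>. ennreal (tent \<theta> * h \<alpha> \<theta>) \<partial>lborel)") auto
    also have "\<dots> \<le> (\<integral>\<^sup>+ \<theta>\<in>{1/2..3/2}. ennreal (h \<alpha> \<theta>) \<partial>lborel)"
    proof (rule nn_integral_mono)
      fix \<theta>
      show "ennreal (tent \<theta> * h \<alpha> \<theta>) \<le> ennreal (h \<alpha> \<theta>) * indicator {1/2..3/2} \<theta>"
      proof (cases "h \<alpha> \<theta> \<ge> 0")
        case True
        then have "tent \<theta> * h \<alpha> \<theta> \<le> indicator {1/2..3/2} \<theta> * h \<alpha> \<theta>"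
          using tent_bounds by (intro mult_right_mono)
        then show ?thesis
          by (auto simp: indicator_def intro!: ennreal_leI ennreal_neg split: if_splits)
      next
        case False
        then have "tent \<theta> * h \<alpha> \<theta> \<le> 0"
          using tent_bounds(1)[of \<theta>] by (simp add: mult_nonneg_nonpos)
        then have "ennreal (tent \<theta> * h \<alpha> \<theta>) = 0" by (rule ennreal_neg)
        then show ?thesis by (simp only: zero_le)
      qed
    qed
    finally show ?case by (simp add: nn_integral_completion)
  qed
  then show ?thesis using J by (intro exI[of _ "J / 2"]) auto
qed

section \<open>Lower bounds for diffusion and subordinated diffusion\<close>

lemma h_measurable [measurable]: "h \<alpha> \<in> borel_measurable borel"
  unfolding h_def[abs_def] psi_def[abs_def] by measurable

text \<open>
  The minorant \<open>g\<close> is the initial value itself in the linear part and a constant in the nonlinear part,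
  where \<open>u \<tau>\<close> is controlled almost everywhere only.
\<close>

lemma heat_semigroup_ge:
  fixes v g :: "real ^ 'n \<Rightarrow> real" and x :: "real ^ 'n"
  assumes \<sigma>: "0 < \<sigma>"
    and [measurable]: "A \<in> sets lebesgue" "g \<in> borel_measurable lebesgue"
    and g: "\<And>y. 0 \<le> g y" "AE y in lebesgue. y \<in> A \<longrightarrow> g y \<le> v y"
    and D: "\<And>y. y \<in> A \<Longrightarrow> norm (x - y) \<le> D"
    and E: "D\<^sup>2 \<le> 4 * \<sigma> * E"
  shows "ennreal ((4 * pi * \<sigma>) powr (- (real CARD('n) / 2)) * exp (- E)) * (\<integral>\<^sup>+ y\<in>A. ennreal (g y) \<partial>lebesgue)
    \<le> heat_semigroup \<sigma> v x"
proof -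
  define K where "K = (4 * pi * \<sigma>) powr (- (real CARD('n) / 2)) * exp (- E)"
  have K0: "0 \<le> K" by (simp add: K_def)
  have K: "K \<le> heat_kernel \<sigma> (x - y)" if "y \<in> A" for y
  proof -
    have "(norm (x - y))\<^sup>2 \<le> D\<^sup>2" using D[OF that] by (intro power_mono) auto
    then have "(norm (x - y))\<^sup>2 / (4 * \<sigma>) \<le> E"
      using \<sigma> E by (simp add: field_simps)
    then show ?thesis
      unfolding K_def heat_kernel_def by (intro mult_left_mono) auto
  qed
  have "ennreal K * (\<integral>\<^sup>+ y\<in>A. ennreal (g y) \<partial>lebesgue) = (\<integral>\<^sup>+ y. ennreal K * (ennreal (g y) * indicator A y) \<partial>lebesgue)"
    by (rule nn_integral_cmult[symmetric]) measurable
  also have "\<dots> \<le> heat_semigroup \<sigma> v x"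
    unfolding heat_semigroup_def
  proof (rule nn_integral_mono_AE)
    show "AE y in lebesgue. ennreal K * (ennreal (g y) * indicator A y) \<le> ennreal (heat_kernel \<sigma> (x - y) * v y)"
      using g(2)
    proof eventually_elim
      case (elim y)
      show ?case
      proof (cases "y \<in> A")
        case True
        then have "K * g y \<le> heat_kernel \<sigma> (x - y) * v y"
          using K[OF True] elim g(1)[of y] K0 by (intro mult_mono) auto
        then show ?thesis
          using True K0 by (simp add: ennreal_mult'[symmetric] ennreal_leI)
      qed simp
    qed
  qed
  finally show ?thesis by (simp add: K_def)
qed

lemma emeasure_lebesgue_cball:
  fixes c :: "'a::euclidean_space"
  assumes "0 \<le> r"
  shows "emeasure lebesgue (cball c r) = ennreal (unit_ball_vol (real DIM('a)) * r powr (real DIM('a)))"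
proof -
  have "emeasure lebesgue (cball c r) = ennreal (unit_ball_vol (real DIM('a)) * r ^ DIM('a))"
    using assms by (simp add: emeasure_cball)
  also have "r ^ DIM('a) = r powr (real DIM('a))"
    using assms by (cases "r = 0") (auto simp: powr_realpow)
  finally show ?thesis .
qed

text \<open>
  Lower constants for the heat flow in two situations: between points of the ball of radius
  \<open>t powr (\<alpha> / 2)\<close> at diffusion times comparable to \<open>t powr \<alpha>\<close>, and from a ball into itself at diffusion
  times at most comparable to its squared radius.
\<close>

definition K_far :: "real \<Rightarrow> real" where
  "K_far N = (6 * pi) powr (- (N / 2)) * exp (- 4)"

definition K_near :: "real \<Rightarrow> real" where
  "K_near N = unit_ball_vol N * (12 * pi) powr (- (N / 2)) * exp (- (1 / 3))"

text \<open>
  The number \<open>\<eta>\<close> is a parameter of its own, not the value of the integral which it bounds, because the final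
  constant may depend on \<open>\<eta>\<close> and on the dimension \<open>N\<close> but not on \<open>\<alpha>\<close>.
\<close>

locale critical_global_solution =
  fixes N \<alpha> p \<eta> :: real and u0 :: "real ^ 'n \<Rightarrow> real" and u :: "real \<Rightarrow> real ^ 'n \<Rightarrow> real"
  assumes \<alpha>: "1 / 2 < \<alpha>" "\<alpha> < 1"
    and N: "N = real CARD('n)"
    and p: "p = 1 + 2 / N"
    and \<eta>: "0 < \<eta>" "ennreal \<eta> \<le> (\<integral>\<^sup>+ \<theta>\<in>{1/2..3/2}. ennreal (h \<alpha> \<theta>) \<partial>lebesgue)"
    and solution: "is_solution \<alpha> p \<infinity> u0 u"
begin

abbreviation \<omega> :: real where "\<omega> \<equiv> unit_ball_vol N"

lemma pos: "0 < N" "0 < \<omega>" "0 < K_far N" "0 < K_near N" "1 < p"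
proof -
  show "0 < N" by (simp add: N)
  then show "0 < \<omega>" "0 < K_far N" "0 < K_near N" "1 < p"
    by (auto simp: K_far_def K_near_def p zero_less_mult_iff)
qed

text \<open>
  Only the part of the subordination integral over \<open>[1/2, 3/2]\<close> is kept.  In \<open>S_op\<close> the additional
  weight \<open>\<theta>\<close> is at least \<open>1 / 2\<close> there.
\<close>

lemma P_op_ge:
  assumes "\<And>\<theta>. 1 / 2 \<le> \<theta> \<Longrightarrow> \<theta> \<le> 3 / 2 \<Longrightarrow> L \<le> heat_semigroup (t powr \<alpha> * \<theta>) v x"
  shows "ennreal \<eta> * L \<le> P_op \<alpha> t v x"
proof -
  have "ennreal \<eta> * L \<le> (\<integral>\<^sup>+ \<theta>\<in>{1/2..3/2}. ennreal (h \<alpha> \<theta>) \<partial>lebesgue) * L"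
    using \<eta> by (rule_tac mult_right_mono) auto
  also have "\<dots> = (\<integral>\<^sup>+ \<theta>. ennreal (h \<alpha> \<theta>) * indicator {1/2..3/2} \<theta> * L \<partial>lebesgue)"
    by (rule nn_integral_multc[symmetric]) (auto intro!: measurable_completion)
  also have "\<dots> \<le> P_op \<alpha> t v x"
    unfolding P_op_def
    using assms by (intro nn_integral_mono) (auto simp: indicator_def intro!: mult_left_mono)
  finally show ?thesis .
qed

lemma S_op_ge:
  assumes "\<And>\<theta>. 1 / 2 \<le> \<theta> \<Longrightarrow> \<theta> \<le> 3 / 2 \<Longrightarrow> L \<le> heat_semigroup (t powr \<alpha> * \<theta>) v x"
  shows "ennreal (\<eta> / 2) * L \<le> S_op \<alpha> t v x"
proof -
  have "ennreal (\<eta> / 2) * L = ennreal (1 / 2) * (ennreal \<eta> * L)"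
  proof -
    have "ennreal (\<eta> / 2) = ennreal (1 / 2) * ennreal \<eta>"
      using \<eta> by (subst ennreal_mult'[symmetric]) auto
    then show ?thesis by (simp only: mult.assoc)
  qed
  also have "\<dots> \<le> ennreal (1 / 2) * ((\<integral>\<^sup>+ \<theta>\<in>{1/2..3/2}. ennreal (h \<alpha> \<theta>) \<partial>lebesgue) * L)"
    using \<eta> by (intro mult_left_mono mult_right_mono) auto
  also have "\<dots> = ennreal (1 / 2) * (\<integral>\<^sup>+ \<theta>. ennreal (h \<alpha> \<theta>) * indicator {1/2..3/2} \<theta> * L \<partial>lebesgue)"
    by (subst nn_integral_multc[symmetric]) (auto intro!: measurable_completion)
  also have "\<dots> = (\<integral>\<^sup>+ \<theta>. ennreal (1 / 2) * (ennreal (h \<alpha> \<theta>) * indicator {1/2..3/2} \<theta> * L) \<partial>lebesgue)"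
    by (subst nn_integral_cmult[symmetric]) (auto intro!: measurable_completion)
  also have "\<dots> \<le> S_op \<alpha> t v x"
    unfolding S_op_def
  proof (rule nn_integral_mono)
    fix \<theta> :: real
    show "ennreal (1 / 2) * (ennreal (h \<alpha> \<theta>) * indicator {1/2..3/2} \<theta> * L)
      \<le> ennreal (\<theta> * h \<alpha> \<theta>) * heat_semigroup (t powr \<alpha> * \<theta>) v x * indicator {0<..} \<theta>"
    proof (cases "\<theta> \<in> {1/2..3/2}")
      case True
      have "ennreal (1 / 2) * ennreal (h \<alpha> \<theta>) \<le> ennreal \<theta> * ennreal (h \<alpha> \<theta>)"
        using True by (intro mult_right_mono ennreal_leI) auto
      also have "\<dots> = ennreal (\<theta> * h \<alpha> \<theta>)"
        using True by (simp add: ennreal_mult')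
      finally have "ennreal (1 / 2) * ennreal (h \<alpha> \<theta>) * L
         \<le> ennreal (\<theta> * h \<alpha> \<theta>) * heat_semigroup (t powr \<alpha> * \<theta>) v x"
        using assms[of \<theta>] True by (intro mult_mono) auto
      then show ?thesis using True by (simp add: mult.assoc)
    qed simp
  qed
  finally show ?thesis .
qed

text \<open>
  Points of the ball have distance at most \<open>2 * t powr (\<alpha> / 2)\<close>, whence the exponent \<open>- 4\<close>; the time
  \<open>\<sigma> \<le> 3 / 2 * t powr \<alpha>\<close> gives the base \<open>4 * pi * 3 / 2\<close> of \<open>K_far\<close>.
\<close>

lemma heat_far:
  fixes v :: "real ^ 'n \<Rightarrow> real"
  assumes t: "0 < t" and \<sigma>: "t powr \<alpha> / 4 \<le> \<sigma>" "\<sigma> \<le> 3 / 2 * t powr \<alpha>"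
    and x: "norm x \<le> t powr (\<alpha> / 2)" and A: "A \<subseteq> cball 0 (t powr (\<alpha> / 2))"
    and m: "A \<in> sets lebesgue" "g \<in> borel_measurable lebesgue"
    and g: "\<And>y. 0 \<le> g y" "AE y in lebesgue. y \<in> A \<longrightarrow> g y \<le> v y"
  shows "ennreal (K_far N * t powr (- (\<alpha> * N / 2))) * (\<integral>\<^sup>+ y\<in>A. ennreal (g y) \<partial>lebesgue) \<le> heat_semigroup \<sigma> v x"
proof -
  have \<sigma>0: "0 < \<sigma>" using t \<sigma>(1) by (auto intro: less_le_trans[of _ "t powr \<alpha> / 4"])
  have "ennreal (K_far N * t powr (- (\<alpha> * N / 2)))
    \<le> ennreal ((4 * pi * \<sigma>) powr (- (N / 2)) * exp (- 4))"
  proof (rule ennreal_leI)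
    have "K_far N * t powr (- (\<alpha> * N / 2)) = (6 * pi * t powr \<alpha>) powr (- (N / 2)) * exp (- 4)"
      using t by (simp add: K_far_def powr_mult powr_powr)
    also have "\<dots> \<le> (4 * pi * \<sigma>) powr (- (N / 2)) * exp (- 4)"
      using \<sigma>0 \<sigma>(2) pos(1) by (intro mult_right_mono powr_mono2') (auto simp: field_simps)
    finally show "K_far N * t powr (- (\<alpha> * N / 2)) \<le> (4 * pi * \<sigma>) powr (- (N / 2)) * exp (- 4)" .
  qed
  then have "ennreal (K_far N * t powr (- (\<alpha> * N / 2))) * (\<integral>\<^sup>+ y\<in>A. ennreal (g y) \<partial>lebesgue)
    \<le> ennreal ((4 * pi * \<sigma>) powr (- (N / 2)) * exp (- 4)) * (\<integral>\<^sup>+ y\<in>A. ennreal (g y) \<partial>lebesgue)"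
    by (rule mult_right_mono) simp
  also have "\<dots> \<le> heat_semigroup \<sigma> v x"
  proof (unfold N, rule heat_semigroup_ge[OF \<sigma>0 m g])
    fix y assume "y \<in> A"
    then have "norm y \<le> t powr (\<alpha> / 2)" using A by auto
    then show "norm (x - y) \<le> 2 * t powr (\<alpha> / 2)"
      using x norm_triangle_ineq4[of x y] by linarith
  next
    have "(t powr (\<alpha> / 2))\<^sup>2 = t powr \<alpha>"
      using t by (simp add: powr_power)
    then show "(2 * t powr (\<alpha> / 2))\<^sup>2 \<le> 4 * \<sigma> * 4"
      using \<sigma>(1) by (simp add: power_mult_distrib)
  qed
  finally show ?thesis .
qed

text \<open>
  For \<open>\<tau> \<le> t / 2\<close> the elapsed time \<open>t - \<tau>\<close> is comparable to \<open>t\<close>, so a height \<open>\<kappa>\<close> on the ball of time \<open>\<tau>\<close>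
  is spread over the ball of time \<open>t\<close> in proportion to its mass.
\<close>

lemma S_op_far:
  fixes v :: "real ^ 'n \<Rightarrow> real"
  assumes \<tau>: "0 < \<tau>" "\<tau> \<le> t / 2" and x: "norm x \<le> t powr (\<alpha> / 2)"
    and \<kappa>: "0 \<le> \<kappa>" "AE y in lebesgue. y \<in> cball 0 (\<tau> powr (\<alpha> / 2)) \<longrightarrow> \<kappa> \<le> v y"
  shows "ennreal (\<eta> / 2 * K_far N * \<omega> * t powr (- (\<alpha> * N / 2)) * \<tau> powr (\<alpha> * N / 2) * \<kappa>)
    \<le> S_op \<alpha> (t - \<tau>) v x"
proof -
  have t: "0 < t" using \<tau> by linarith
  let ?A = "cball 0 (\<tau> powr (\<alpha> / 2)) :: (real ^ 'n) set"
  have "emeasure lebesgue ?A = ennreal (\<omega> * \<tau> powr (\<alpha> * N / 2))"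
    by (subst emeasure_lebesgue_cball) (simp_all add: N powr_powr)
  then have I: "(\<integral>\<^sup>+ y\<in>?A. ennreal \<kappa> \<partial>lebesgue) = ennreal (\<kappa> * (\<omega> * \<tau> powr (\<alpha> * N / 2)))"
    using \<kappa> by (simp add: nn_integral_cmult_indicator ennreal_mult')
  have sub: "?A \<subseteq> cball 0 (t powr (\<alpha> / 2))"
    using \<tau> \<alpha> by (intro subset_cball powr_mono2) auto
  have s: "t powr \<alpha> / 2 \<le> (t - \<tau>) powr \<alpha>" "(t - \<tau>) powr \<alpha> \<le> t powr \<alpha>"
  proof -
    have "2 powr \<alpha> \<le> 2 powr (1::real)" using \<alpha> by (intro powr_mono) auto
    then have "t powr \<alpha> / 2 \<le> t powr \<alpha> / 2 powr \<alpha>" by (intro divide_left_mono) auto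
    also have "\<dots> = (t / 2) powr \<alpha>" using t by (simp add: powr_divide)
    also have "\<dots> \<le> (t - \<tau>) powr \<alpha>" using \<tau> \<alpha> by (intro powr_mono2) auto
    finally show "t powr \<alpha> / 2 \<le> (t - \<tau>) powr \<alpha>" .
    show "(t - \<tau>) powr \<alpha> \<le> t powr \<alpha>" using \<tau> \<alpha> by (intro powr_mono2) auto
  qed
  have "ennreal (\<eta> / 2 * K_far N * \<omega> * t powr (- (\<alpha> * N / 2)) * \<tau> powr (\<alpha> * N / 2) * \<kappa>)
    = ennreal (\<eta> / 2) * (ennreal (K_far N * t powr (- (\<alpha> * N / 2))) * (\<integral>\<^sup>+ y\<in>?A. ennreal \<kappa> \<partial>lebesgue))"
    unfolding I using pos \<eta>(1) \<kappa>(1) by (simp add: ennreal_mult'[symmetric] mult_ac)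
  also have "\<dots> \<le> S_op \<alpha> (t - \<tau>) v x"
  proof (rule S_op_ge, rule heat_far[where g="\<lambda>_. \<kappa>", OF t _ _ x sub])
    fix \<theta> :: real assume \<theta>: "1 / 2 \<le> \<theta>" "\<theta> \<le> 3 / 2"
    have "t powr \<alpha> / 2 * (1 / 2) \<le> (t - \<tau>) powr \<alpha> * \<theta>"
      using s \<theta> by (intro mult_mono) auto
    then show "t powr \<alpha> / 4 \<le> (t - \<tau>) powr \<alpha> * \<theta>" by simp
    have "(t - \<tau>) powr \<alpha> * \<theta> \<le> t powr \<alpha> * (3 / 2)"
      using s \<theta> by (intro mult_mono) auto
    then show "(t - \<tau>) powr \<alpha> * \<theta> \<le> 3 / 2 * t powr \<alpha>" by simp
  qed (use \<kappa> in auto)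
  finally show ?thesis .
qed

text \<open>
  The heat flow from a ball into itself does not degenerate for small times: every point \<open>x\<close> of the
  ball of radius \<open>r\<close> has, within distance \<open>2 * \<rho>\<close>, a whole ball of radius \<open>\<rho>\<close> contained in the large
  one, obtained by moving \<open>x\<close> towards the centre, and \<open>\<rho>\<close> may be taken of the order of the square root of the
  diffusion time.
\<close>

lemma S_op_near:
  fixes v :: "real ^ 'n \<Rightarrow> real"
  assumes s: "0 < s" "s powr \<alpha> \<le> 2 * r\<^sup>2" and r: "0 < r" and x: "norm x \<le> r"
    and \<kappa>: "0 \<le> \<kappa>" "AE y in lebesgue. y \<in> cball 0 r \<longrightarrow> \<kappa> \<le> v y"
  shows "ennreal (\<eta> / 2 * K_near N * \<kappa>) \<le> S_op \<alpha> s v x"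
proof -
  have "ennreal (K_near N * \<kappa>) \<le> heat_semigroup (s powr \<alpha> * \<theta>) v x"
    if \<theta>: "1 / 2 \<le> \<theta>" "\<theta> \<le> 3 / 2" for \<theta>
  proof -
    define \<sigma> where "\<sigma> = s powr \<alpha> * \<theta>"
    have \<sigma>0: "0 < \<sigma>" using s \<theta> by (simp add: \<sigma>_def)
    have "\<sigma> \<le> 2 * r\<^sup>2 * (3 / 2)"
      unfolding \<sigma>_def using s \<theta> by (intro mult_mono) auto
    then have \<sigma>1: "\<sigma> / 3 \<le> r\<^sup>2" by simp
    \<comment> \<open>the factor \<open>3\<close> makes \<open>\<rho> \<le> r\<close> for all admissible diffusion times\<close>
    define \<rho> where "\<rho> = sqrt (\<sigma> / 3)"
    have \<rho>: "0 < \<rho>" "\<rho>\<^sup>2 = \<sigma> / 3" using \<sigma>0 by (auto simp: \<rho>_def)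
    have \<rho>r: "\<rho> \<le> r" unfolding \<rho>_def using \<sigma>1 r by (intro real_le_lsqrt) auto
    define c where "c = (1 - \<rho> / r) *\<^sub>R x"
    have k: "0 \<le> 1 - \<rho> / r" using \<rho>r r by simp
    let ?A = "cball c \<rho>"
    have nc: "norm c \<le> r - \<rho>"
    proof -
      have "norm c = (1 - \<rho> / r) * norm x" using k by (simp add: c_def)
      also have "\<dots> \<le> (1 - \<rho> / r) * r" using x k by (rule mult_left_mono)
      finally show ?thesis using r by (simp add: left_diff_distrib)
    qed
    have xc: "norm (x - c) \<le> \<rho>"
    proof -
      have "x - c = (\<rho> / r) *\<^sub>R x" by (simp add: c_def algebra_simps)
      then have "norm (x - c) = \<rho> / r * norm x" using \<rho> r by simp
      also have "\<dots> \<le> \<rho> / r * r" using x \<rho> r by (intro mult_left_mono) auto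
      finally show ?thesis using r by simp
    qed
    have sub: "y \<in> cball 0 r" if "y \<in> ?A" for y
      using that nc norm_triangle_ineq[of "y - c" c] by (simp add: dist_norm norm_minus_commute)
    have "emeasure lebesgue ?A = ennreal (\<omega> * (\<sigma> / 3) powr (N / 2))"
    proof -
      have "\<rho> powr N = (\<sigma> / 3) powr (N / 2)"
        using \<sigma>0 by (simp add: \<rho>_def powr_half_sqrt[symmetric] powr_powr)
      then show ?thesis
        using \<rho>(1) by (subst emeasure_lebesgue_cball) (simp_all add: N)
    qed
    then have I: "(\<integral>\<^sup>+ y\<in>?A. ennreal \<kappa> \<partial>lebesgue) = ennreal (\<kappa> * (\<omega> * (\<sigma> / 3) powr (N / 2)))"
      using \<kappa> by (simp add: nn_integral_cmult_indicator ennreal_mult')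
    have K: "K_near N = (4 * pi * \<sigma>) powr (- (N / 2)) * exp (- (1 / 3)) * (\<omega> * (\<sigma> / 3) powr (N / 2))"
    proof -
      have "4 * pi * \<sigma> = 12 * pi * (\<sigma> / 3)" by simp
      then have "(4 * pi * \<sigma>) powr (- (N / 2)) = (12 * pi) powr (- (N / 2)) * (\<sigma> / 3) powr (- (N / 2))"
        using \<sigma>0 by (simp only:) (subst powr_mult, auto)
      moreover have "(\<sigma> / 3) powr (- (N / 2)) * (\<sigma> / 3) powr (N / 2) = 1"
        using \<sigma>0 by (simp flip: powr_add)
      ultimately show ?thesis by (simp add: K_near_def)
    qed
    have "ennreal (K_near N * \<kappa>) = ennreal ((4 * pi * \<sigma>) powr (- (N / 2)) * exp (- (1 / 3))) * (\<integral>\<^sup>+ y\<in>?A. ennreal \<kappa> \<partial>lebesgue)"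
      unfolding I K using pos \<kappa>(1) by (simp add: ennreal_mult'[symmetric] mult_ac)
    also have "\<dots> \<le> heat_semigroup \<sigma> v x"
    proof (unfold N, rule heat_semigroup_ge[OF \<sigma>0])
      show "AE y in lebesgue. y \<in> ?A \<longrightarrow> \<kappa> \<le> v y"
        using \<kappa>(2) by eventually_elim (use sub in auto)
      fix y assume "y \<in> ?A"
      then have "norm (c - y) \<le> \<rho>" by (simp add: dist_norm)
      then show "norm (x - y) \<le> 2 * \<rho>"
        using xc norm_triangle_ineq[of "x - c" "c - y"] by simp
    next
      show "(2 * \<rho>)\<^sup>2 \<le> 4 * \<sigma> * (1 / 3)"
        using \<rho> by (simp add: power_mult_distrib)
    qed (use \<kappa> in auto)
    finally show ?thesis by (simp add: \<sigma>_def)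
  qed
  from S_op_ge[OF this] show ?thesis
    using \<eta>(1) by (simp add: ennreal_mult'[symmetric] mult.assoc)
qed

lemma solution_integral_equation:
  assumes "0 < t"
  shows "AE x in lebesgue. ennreal (u t x) = P_op \<alpha> t u0 x +
             ennreal \<alpha> * (\<integral>\<^sup>+ \<tau>\<in>{0<..<t}. ennreal ((t - \<tau>) powr (\<alpha> - 1))
                                     * S_op \<alpha> (t - \<tau>) (\<lambda>y. u \<tau> y powr p) x \<partial>lebesgue)"
  using solution assms unfolding is_solution_def by simp

text \<open>
  The only way in which the nonlinear part of the integral equation is used.  The time window ends
  strictly before \<open>t\<close>, so that it lies in the open interval of integration.
\<close>

lemma duhamel_lower_bound:
  assumes t: "0 < a" "b < t" and c: "0 \<le> c"
    and f: "\<And>x \<tau>. x \<in> X \<Longrightarrow> a \<le> \<tau> \<Longrightarrow> \<tau> \<le> b \<Longrightarrow> ennreal (f \<tau>) \<le> S_op \<alpha> (t - \<tau>) (\<lambda>y. u \<tau> y powr p) x"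
    and I: "ennreal c \<le> (\<integral>\<^sup>+ \<tau>\<in>{a..b}. ennreal ((t - \<tau>) powr (\<alpha> - 1) * f \<tau>) \<partial>lebesgue)"
    and ab: "a \<le> b"
  shows "AE x in lebesgue. x \<in> X \<longrightarrow> \<alpha> * c \<le> u t x"
proof -
  have t0: "0 < t" using t ab by simp
  show ?thesis
    using solution_integral_equation[OF t0]
  proof eventually_elim
    case (elim x)
    show ?case
    proof
      assume x: "x \<in> X"
      have "ennreal c \<le> (\<integral>\<^sup>+ \<tau>\<in>{0<..<t}. ennreal ((t - \<tau>) powr (\<alpha> - 1))
                                     * S_op \<alpha> (t - \<tau>) (\<lambda>y. u \<tau> y powr p) x \<partial>lebesgue)"
        using t f[OF x] by (intro order_trans[OF I] nn_integral_mono)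
          (auto simp: indicator_def ennreal_mult' intro!: mult_left_mono)
      then have "ennreal \<alpha> * ennreal c \<le> ennreal (u t x)"
        unfolding elim using \<alpha> by (intro add_increasing mult_left_mono) auto
      then have "ennreal (\<alpha> * c) \<le> ennreal (u t x)"
        using \<alpha> by (simp add: ennreal_mult')
      moreover have "0 \<le> u t x"
        using solution t0 unfolding is_solution_def by simp
      ultimately show "\<alpha> * c \<le> u t x" by simp
    qed
  qed
qed

end

section \<open>Growth of the self-similar profile\<close>

lemma nn_integral_powr_minus_Icc:
  assumes "0 < a" "a \<le> b" "\<alpha> < (1::real)"
  shows "(\<integral>\<^sup>+ \<tau>\<in>{a..b}. ennreal (\<tau> powr (- \<alpha>)) \<partial>lebesgue)
    = ennreal ((b powr (1 - \<alpha>) - a powr (1 - \<alpha>)) / (1 - \<alpha>))"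
proof -
  have "(\<integral>\<^sup>+ \<tau>\<in>{a..b}. ennreal (\<tau> powr (- \<alpha>)) \<partial>lborel)
    = ennreal (b powr (1 - \<alpha>) / (1 - \<alpha>) - a powr (1 - \<alpha>) / (1 - \<alpha>))"
  proof (rule nn_integral_FTC_Icc)
    fix x assume "x \<in> {a..b}"
    then show "((\<lambda>x. x powr (1 - \<alpha>) / (1 - \<alpha>)) has_real_derivative x powr (- \<alpha>)) (at x)"
      using DERIV_cdivide[OF has_real_derivative_powr[of x "1 - \<alpha>"], of "1 - \<alpha>"] assms by simp
  next
    show "a \<le> b" by fact
  qed (use assms in auto)
  then show ?thesis by (simp add: nn_integral_completion diff_divide_distrib)
qed

context critical_global_solution
begin

text \<open>
  The power of \<open>t\<close> is the one for which the mass of the right-hand side on the parabolic ball is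
  proportional to \<open>m\<close>, independently of \<open>t\<close>.
\<close>

definition profile_bound :: "real \<Rightarrow> real \<Rightarrow> bool" where
  "profile_bound m t\<^sub>0 \<longleftrightarrow> (\<forall>t\<ge>t\<^sub>0. AE x in lebesgue.
     norm x \<le> t powr (\<alpha> / 2) \<longrightarrow> m * t powr (- (\<alpha> * N / 2)) \<le> u t x)"

text \<open>
  The decisive factor \<open>1 / (1 - \<alpha>)\<close> is the integral of the memory kernel against
  \<open>\<tau> powr (- \<alpha>)\<close>; the remaining factors come from \<open>S_op_far\<close>, from \<open>\<alpha> \<ge> 1 / 2\<close> and from truncating that
  integral.
\<close>

definition gain :: real where
  "gain = \<eta> * K_far N * \<omega> / (16 * (1 - \<alpha>))"

lemma gain_pos: "0 < gain"
  using \<alpha> \<eta> pos by (simp add: gain_def)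

lemma profile_bound_mono:
  assumes "profile_bound m t\<^sub>0" "m' \<le> m"
  shows "profile_bound m' t\<^sub>0"
  unfolding profile_bound_def
proof (intro allI impI)
  fix t assume "t\<^sub>0 \<le> t"
  then have "AE x in lebesgue. norm x \<le> t powr (\<alpha> / 2) \<longrightarrow> m * t powr (- (\<alpha> * N / 2)) \<le> u t x"
    using assms(1) by (simp add: profile_bound_def)
  moreover have "m' * t powr (- (\<alpha> * N / 2)) \<le> m * t powr (- (\<alpha> * N / 2))"
    using assms(2) by (intro mult_right_mono) auto
  ultimately show "AE x in lebesgue. norm x \<le> t powr (\<alpha> / 2) \<longrightarrow> m' * t powr (- (\<alpha> * N / 2)) \<le> u t x"
    by (auto elim: eventually_mono)
qed

text \<open>
  Once the parabolic ball contains \<open>cball 0 r\<close>, the linear evolution of the mass in \<open>cball 0 r\<close>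
  already has the self-similar size.
\<close>

lemma profile_bound_initial:
  assumes M: "0 \<le> M" "ennreal M \<le> (\<integral>\<^sup>+ y\<in>cball 0 r. ennreal (u0 y) \<partial>lebesgue)" and r: "0 < r"
  shows "profile_bound (\<eta> * K_far N * M) (r powr (2 / \<alpha>))"
  unfolding profile_bound_def
proof (intro allI impI)
  fix t assume "r powr (2 / \<alpha>) \<le> t"
  moreover have "0 < r powr (2 / \<alpha>)" using r by simp
  ultimately have t: "0 < t" "(r powr (2 / \<alpha>)) powr (\<alpha> / 2) \<le> t powr (\<alpha> / 2)"
    using \<alpha> by (linarith, intro powr_mono2) auto
  then have sub: "cball 0 r \<subseteq> (cball 0 (t powr (\<alpha> / 2)) :: (real ^ 'n) set)"
    using r \<alpha> by (intro subset_cball) (simp add: powr_powr)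
  have u0: "\<And>y. 0 \<le> u0 y" "u0 \<in> borel_measurable lebesgue"
    using solution unfolding is_solution_def by auto
  show "AE x in lebesgue. norm x \<le> t powr (\<alpha> / 2) \<longrightarrow> \<eta> * K_far N * M * t powr (- (\<alpha> * N / 2)) \<le> u t x"
    using solution_integral_equation[OF t(1)]
  proof eventually_elim
    case (elim x)
    show ?case
    proof
      assume x: "norm x \<le> t powr (\<alpha> / 2)"
      have "ennreal (\<eta> * K_far N * M * t powr (- (\<alpha> * N / 2)))
        = ennreal \<eta> * (ennreal (K_far N * t powr (- (\<alpha> * N / 2))) * ennreal M)"
        using \<eta>(1) pos M(1) by (simp add: ennreal_mult'[symmetric] mult_ac)
      also have "\<dots> \<le> ennreal \<eta> * (ennreal (K_far N * t powr (- (\<alpha> * N / 2))) * (\<integral>\<^sup>+ y\<in>cball 0 r. ennreal (u0 y) \<partial>lebesgue))"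
        using M(2) by (intro mult_left_mono) auto
      also have "\<dots> \<le> P_op \<alpha> t u0 x"
      proof (rule P_op_ge, rule heat_far[where g=u0, OF t(1) _ _ x sub])
        fix \<theta> :: real assume \<theta>: "1 / 2 \<le> \<theta>" "\<theta> \<le> 3 / 2"
        have "t powr \<alpha> * (1 / 4) \<le> t powr \<alpha> * \<theta>" "t powr \<alpha> * \<theta> \<le> t powr \<alpha> * (3 / 2)"
          using \<theta> by (intro mult_left_mono; simp)+
        then show "t powr \<alpha> / 4 \<le> t powr \<alpha> * \<theta>" "t powr \<alpha> * \<theta> \<le> 3 / 2 * t powr \<alpha>"
          by simp_all
      qed (use u0 in auto)
      also have "\<dots> \<le> ennreal (u t x)"
        unfolding elim by (rule add_increasing2) auto
      finally have "ennreal (\<eta> * K_far N * M * t powr (- (\<alpha> * N / 2))) \<le> ennreal (u t x)" .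
      moreover have "0 \<le> u t x"
        using solution t unfolding is_solution_def by simp
      ultimately show "\<eta> * K_far N * M * t powr (- (\<alpha> * N / 2)) \<le> u t x" by simp
    qed
  qed
qed

text \<open>
  By \<open>p = 1 + 2 / N\<close> the source at time \<open>\<tau>\<close> contributes \<open>m powr p * \<tau> powr (- \<alpha>)\<close> to the profile constant.
  Only the times \<open>t\<^sub>0 \<le> \<tau> \<le> t / 2\<close> are used.  Waiting until \<open>t powr (1 - \<alpha>)\<close> is four times
  \<open>t\<^sub>0 powr (1 - \<alpha>)\<close> ensures that they contribute a fixed fraction of the full integral; the waiting
  factor is astronomically large for \<open>\<alpha>\<close> close to \<open>1\<close>, but a global solution has the time.
\<close>

lemma profile_bound_step:
  assumes t0: "0 < t\<^sub>0" and m: "0 \<le> m" and bound: "profile_bound m t\<^sub>0"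
  shows "profile_bound (gain * m powr p) (4 powr (1 / (1 - \<alpha>)) * t\<^sub>0)"
  unfolding profile_bound_def
proof (intro allI impI)
  fix t assume t: "4 powr (1 / (1 - \<alpha>)) * t\<^sub>0 \<le> t"
  have "(4::real) powr 1 \<le> 4 powr (1 / (1 - \<alpha>))"
    using \<alpha> by (intro powr_mono) auto
  then have "4 * t\<^sub>0 \<le> 4 powr (1 / (1 - \<alpha>)) * t\<^sub>0"
    using t0 by (intro mult_right_mono) auto
  then have t4: "4 * t\<^sub>0 \<le> t" using t by linarith
  then have tpos: "0 < t" using t0 by linarith
  define C where "C = \<eta> / 2 * K_far N * \<omega> * t powr (- (\<alpha> * N / 2)) * m powr p"
  have C: "0 \<le> C" using \<eta> pos by (simp add: C_def)
  let ?I = "((t / 2) powr (1 - \<alpha>) - t\<^sub>0 powr (1 - \<alpha>)) / (1 - \<alpha>)"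
  \<comment> \<open>the truncated Beta integral, with the memory kernel replaced by its lower bound \<open>t powr (\<alpha> - 1)\<close>\<close>
  have time: "t powr (\<alpha> - 1) * ?I \<ge> 1 / (4 * (1 - \<alpha>))"
  proof -
    have "2 powr (1 - \<alpha>) \<le> 2 powr (1::real)" using \<alpha> by (intro powr_mono) auto
    then have "t powr (1 - \<alpha>) / 2 \<le> t powr (1 - \<alpha>) / 2 powr (1 - \<alpha>)" by (intro divide_left_mono) auto
    also have "\<dots> = (t / 2) powr (1 - \<alpha>)" using tpos by (simp add: powr_divide)
    finally have 1: "t powr (1 - \<alpha>) / 2 \<le> (t / 2) powr (1 - \<alpha>)" .
    have "4 * t\<^sub>0 powr (1 - \<alpha>) = (4 powr (1 / (1 - \<alpha>)) * t\<^sub>0) powr (1 - \<alpha>)"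
      using \<alpha> t0 by (simp add: powr_mult powr_powr)
    also have "\<dots> \<le> t powr (1 - \<alpha>)"
      using t t0 \<alpha> by (intro powr_mono2) auto
    finally have "t powr (1 - \<alpha>) / 4 \<le> (t / 2) powr (1 - \<alpha>) - t\<^sub>0 powr (1 - \<alpha>)"
      using 1 by linarith
    then have "t powr (\<alpha> - 1) * (t powr (1 - \<alpha>) / 4 / (1 - \<alpha>)) \<le> t powr (\<alpha> - 1) * ?I"
      using \<alpha> by (intro mult_left_mono divide_right_mono) auto
    moreover have "t powr (\<alpha> - 1) * t powr (1 - \<alpha>) = 1"
      using tpos by (simp flip: powr_add)
    ultimately show ?thesis by simp
  qed
  have "AE x in lebesgue. x \<in> cball 0 (t powr (\<alpha> / 2)) \<longrightarrow> \<alpha> * (C / (4 * (1 - \<alpha>))) \<le> u t x"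
  proof (rule duhamel_lower_bound[where f="\<lambda>\<tau>. C * \<tau> powr (- \<alpha>)"])
    show "0 < t\<^sub>0" "t / 2 < t" "t\<^sub>0 \<le> t / 2" using t0 t4 by auto
    show "0 \<le> C / (4 * (1 - \<alpha>))" using C \<alpha> by simp
  next
    fix x :: "real ^ 'n" and \<tau>
    assume x: "x \<in> cball 0 (t powr (\<alpha> / 2))" and \<tau>: "t\<^sub>0 \<le> \<tau>" "\<tau> \<le> t / 2"
    have \<tau>0: "0 < \<tau>" using \<tau> t0 by linarith
    let ?\<kappa> = "(m * \<tau> powr (- (\<alpha> * N / 2))) powr p"
    have "AE y in lebesgue. norm y \<le> \<tau> powr (\<alpha> / 2) \<longrightarrow> m * \<tau> powr (- (\<alpha> * N / 2)) \<le> u \<tau> y"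
      using bound \<tau>(1) by (simp add: profile_bound_def)
    then have "AE y in lebesgue. y \<in> cball 0 (\<tau> powr (\<alpha> / 2)) \<longrightarrow> ?\<kappa> \<le> u \<tau> y powr p"
      by eventually_elim (use m pos in \<open>auto intro!: powr_mono2\<close>)
    then have "ennreal (\<eta> / 2 * K_far N * \<omega> * t powr (- (\<alpha> * N / 2)) * \<tau> powr (\<alpha> * N / 2) * ?\<kappa>)
      \<le> S_op \<alpha> (t - \<tau>) (\<lambda>y. u \<tau> y powr p) x"
      using x \<tau>0 \<tau> by (intro S_op_far) auto
    also have "\<eta> / 2 * K_far N * \<omega> * t powr (- (\<alpha> * N / 2)) * \<tau> powr (\<alpha> * N / 2) * ?\<kappa> = C * \<tau> powr (- \<alpha>)"
    proof -
      have "?\<kappa> = m powr p * \<tau> powr (- (\<alpha> * N / 2) * p)"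
        using m \<tau>0 by (simp add: powr_mult powr_powr)
      moreover have "\<tau> powr (\<alpha> * N / 2) * \<tau> powr (- (\<alpha> * N / 2) * p) = \<tau> powr (- \<alpha>)"
        unfolding powr_add[symmetric] p using pos(1) by (intro arg_cong2[where f="(powr)"]) (auto simp: field_simps)
      ultimately show ?thesis
        by (simp add: C_def)
    qed
    finally show "ennreal (C * \<tau> powr (- \<alpha>)) \<le> S_op \<alpha> (t - \<tau>) (\<lambda>y. u \<tau> y powr p) x" .
  next
    have "C / (4 * (1 - \<alpha>)) \<le> C * t powr (\<alpha> - 1) * ?I"
      using mult_left_mono[OF time C] by (simp add: mult.assoc)
    then have "ennreal (C / (4 * (1 - \<alpha>))) \<le> ennreal (C * t powr (\<alpha> - 1)) * ennreal ?I"
      using C by (subst ennreal_mult'[symmetric]) (auto intro: ennreal_leI)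
    also have "\<dots> = (\<integral>\<^sup>+ \<tau>. ennreal (C * t powr (\<alpha> - 1)) * (ennreal (\<tau> powr (- \<alpha>)) * indicator {t\<^sub>0..t / 2} \<tau>) \<partial>lebesgue)"
      using t0 t4 \<alpha> by (subst nn_integral_powr_minus_Icc[symmetric])
        (auto intro!: nn_integral_cmult[symmetric] measurable_completion)
    also have "\<dots> \<le> (\<integral>\<^sup>+ \<tau>\<in>{t\<^sub>0..t / 2}. ennreal ((t - \<tau>) powr (\<alpha> - 1) * (C * \<tau> powr (- \<alpha>))) \<partial>lebesgue)"
    proof (rule nn_integral_mono)
      fix \<tau>
      show "ennreal (C * t powr (\<alpha> - 1)) * (ennreal (\<tau> powr (- \<alpha>)) * indicator {t\<^sub>0..t / 2} \<tau>)
        \<le> ennreal ((t - \<tau>) powr (\<alpha> - 1) * (C * \<tau> powr (- \<alpha>))) * indicator {t\<^sub>0..t / 2} \<tau>"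
      proof (cases "\<tau> \<in> {t\<^sub>0..t / 2}")
        case True
        then have "t powr (\<alpha> - 1) \<le> (t - \<tau>) powr (\<alpha> - 1)"
          using t0 tpos \<alpha> by (intro powr_mono2') auto
        then have "t powr (\<alpha> - 1) * (C * \<tau> powr (- \<alpha>)) \<le> (t - \<tau>) powr (\<alpha> - 1) * (C * \<tau> powr (- \<alpha>))"
          using C by (intro mult_right_mono) auto
        then have "C * t powr (\<alpha> - 1) * \<tau> powr (- \<alpha>) \<le> (t - \<tau>) powr (\<alpha> - 1) * (C * \<tau> powr (- \<alpha>))"
          by (simp add: mult_ac)
        then show ?thesis
          using True C by (simp add: ennreal_mult'[symmetric] ennreal_leI)
      qed simp
    qed
    finally show "ennreal (C / (4 * (1 - \<alpha>)))
      \<le> (\<integral>\<^sup>+ \<tau>\<in>{t\<^sub>0..t / 2}. ennreal ((t - \<tau>) powr (\<alpha> - 1) * (C * \<tau> powr (- \<alpha>))) \<partial>lebesgue)" .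
  qed
  moreover have "gain * m powr p * t powr (- (\<alpha> * N / 2)) \<le> \<alpha> * (C / (4 * (1 - \<alpha>)))"
  proof -
    have "gain * m powr p * t powr (- (\<alpha> * N / 2)) = 1 / 2 * (C / (4 * (1 - \<alpha>)))"
      by (simp add: gain_def C_def)
    also have "\<dots> \<le> \<alpha> * (C / (4 * (1 - \<alpha>)))"
      using \<alpha> C by (intro mult_right_mono) auto
    finally show ?thesis .
  qed
  ultimately show "AE x in lebesgue. norm x \<le> t powr (\<alpha> / 2)
      \<longrightarrow> gain * m powr p * t powr (- (\<alpha> * N / 2)) \<le> u t x"
    by (auto elim!: eventually_mono order_trans simp del: times_divide_eq_right)
qed

text \<open>
  Above the threshold every step at least doubles the constant, and the threshold persists since
  \<open>gain * m powr (p - 1)\<close> increases with \<open>m\<close>.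
\<close>

lemma profile_bound_arbitrarily_large:
  assumes t0: "0 < t\<^sub>0" and m: "0 < m" and bound: "profile_bound m t\<^sub>0"
    and threshold: "2 \<le> gain * m powr (p - 1)"
  shows "\<exists>t>0. profile_bound m' t"
proof -
  have "\<exists>t>0. profile_bound (2 ^ k * m) t" for k
  proof (induction k)
    case 0
    then show ?case using t0 bound by auto
  next
    case (Suc k)
    then obtain t where t: "0 < t" "profile_bound (2 ^ k * m) t" by auto
    have "profile_bound (gain * (2 ^ k * m) powr p) (4 powr (1 / (1 - \<alpha>)) * t)"
      using t m by (intro profile_bound_step) auto
    moreover have "2 ^ Suc k * m \<le> gain * (2 ^ k * m) powr p"
    proof -
      have "m powr (p - 1) \<le> (2 ^ k * m) powr (p - 1)"
        using m pos by (intro powr_mono2) auto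
      then have "2 \<le> gain * (2 ^ k * m) powr (p - 1)"
        using threshold gain_pos by (auto intro: order_trans mult_left_mono)
      then have "2 * (2 ^ k * m) \<le> gain * (2 ^ k * m) powr (p - 1) * (2 ^ k * m)"
        using m by (intro mult_right_mono) auto
      also have "\<dots> = gain * (2 ^ k * m) powr p"
        using m by (simp add: powr_diff)
      finally show ?thesis by simp
    qed
    ultimately show ?case
      using t by (intro exI[of _ "4 powr (1 / (1 - \<alpha>)) * t"]) (auto intro: profile_bound_mono)
  qed
  moreover obtain k where "m' / m < 2 ^ k"
    using real_arch_pow[of 2 "m' / m"] by auto
  then have "m' \<le> 2 ^ k * m" using m by (simp add: field_simps)
  ultimately show ?thesis using profile_bound_mono by blast
qed

section \<open>Blow-up on a fixed ball\<close>

definition local_bound :: "real \<Rightarrow> real \<Rightarrow> real \<Rightarrow> bool" where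
  "local_bound T K s \<longleftrightarrow> (\<forall>t\<in>{s..3 * T}. AE x in lebesgue. norm x \<le> T powr (\<alpha> / 2) \<longrightarrow> K \<le> u t x)"

lemma local_bound_mono:
  assumes "local_bound T K s" "K' \<le> K"
  shows "local_bound T K' s"
  unfolding local_bound_def
proof
  fix t assume "t \<in> {s..3 * T}"
  then have "AE x in lebesgue. norm x \<le> T powr (\<alpha> / 2) \<longrightarrow> K \<le> u t x"
    using assms(1) by (simp add: local_bound_def)
  then show "AE x in lebesgue. norm x \<le> T powr (\<alpha> / 2) \<longrightarrow> K' \<le> u t x"
    by eventually_elim (use assms(2) in auto)
qed

text \<open>
  A source window of length \<open>d\<close> followed by a gap of length \<open>d\<close>, which keeps the window strictly before \<open>t\<close>.
  For all times involved \<open>t - \<tau> \<le> 2 * T\<close>, hence \<open>S_op_near\<close> applies on the ball of radius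
  \<open>T powr (\<alpha> / 2)\<close>.
\<close>

lemma local_bound_step:
  assumes T: "0 < T" "T \<le> s" and d: "0 < d" and K: "0 \<le> K" and bound: "local_bound T K s"
  shows "local_bound T (\<alpha> * d * (2 * T) powr (\<alpha> - 1) * (\<eta> / 2 * K_near N) * K powr p) (s + 2 * d)"
  unfolding local_bound_def
proof
  fix t assume t: "t \<in> {s + 2 * d..3 * T}"
  define C where "C = \<eta> / 2 * K_near N * K powr p"
  have C: "0 \<le> C" using \<eta> pos by (simp add: C_def)
  have "AE x in lebesgue. x \<in> cball 0 (T powr (\<alpha> / 2)) \<longrightarrow> \<alpha> * (d * ((2 * T) powr (\<alpha> - 1) * C)) \<le> u t x"
  proof (rule duhamel_lower_bound[where f="\<lambda>_. C"])
    show "0 < s" "s + d < t" "s \<le> s + d" using T t d by auto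
    show "0 \<le> d * ((2 * T) powr (\<alpha> - 1) * C)" using C d by simp
  next
    fix x :: "real ^ 'n" and \<tau>
    assume x: "x \<in> cball 0 (T powr (\<alpha> / 2))" and \<tau>: "s \<le> \<tau>" "\<tau> \<le> s + d"
    have "AE y in lebesgue. norm y \<le> T powr (\<alpha> / 2) \<longrightarrow> K \<le> u \<tau> y"
      using bound \<tau> t d by (simp add: local_bound_def)
    then have "AE y in lebesgue. y \<in> cball 0 (T powr (\<alpha> / 2)) \<longrightarrow> K powr p \<le> u \<tau> y powr p"
      by eventually_elim (use K pos in \<open>auto intro!: powr_mono2\<close>)
    moreover have "(t - \<tau>) powr \<alpha> \<le> 2 * (T powr (\<alpha> / 2))\<^sup>2"
    proof -
      have two: "2 powr \<alpha> \<le> 2 powr (1::real)"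
        using \<alpha> by (intro powr_mono) auto
      have "(t - \<tau>) powr \<alpha> \<le> (2 * T) powr \<alpha>"
        using \<tau> t d T \<alpha> by (intro powr_mono2) auto
      also have "\<dots> = 2 powr \<alpha> * T powr \<alpha>"
        using T by (simp add: powr_mult)
      also have "\<dots> \<le> 2 * T powr \<alpha>"
        using two by (intro mult_right_mono) auto
      also have "\<dots> = 2 * (T powr (\<alpha> / 2))\<^sup>2"
        using T by (simp add: powr_power)
      finally show ?thesis .
    qed
    ultimately show "ennreal C \<le> S_op \<alpha> (t - \<tau>) (\<lambda>y. u \<tau> y powr p) x"
      unfolding C_def using x \<tau> t d T by (intro S_op_near[where r="T powr (\<alpha> / 2)"]) auto
  next
    have "ennreal (d * ((2 * T) powr (\<alpha> - 1) * C)) = ennreal ((2 * T) powr (\<alpha> - 1) * C) * emeasure lebesgue {s..s + d}"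
      using d C by (simp add: ennreal_mult'[symmetric] mult.commute)
    also have "\<dots> = (\<integral>\<^sup>+ \<tau>. ennreal ((2 * T) powr (\<alpha> - 1) * C) * indicator {s..s + d} \<tau> \<partial>lebesgue)"
      by (subst nn_integral_cmult_indicator) auto
    also have "\<dots> \<le> (\<integral>\<^sup>+ \<tau>\<in>{s..s + d}. ennreal ((t - \<tau>) powr (\<alpha> - 1) * C) \<partial>lebesgue)"
    proof (rule nn_integral_mono)
      fix \<tau>
      show "ennreal ((2 * T) powr (\<alpha> - 1) * C) * indicator {s..s + d} \<tau>
        \<le> ennreal ((t - \<tau>) powr (\<alpha> - 1) * C) * indicator {s..s + d} \<tau>"
      proof (cases "\<tau> \<in> {s..s + d}")
        case True
        then have "(2 * T) powr (\<alpha> - 1) \<le> (t - \<tau>) powr (\<alpha> - 1)"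
          using T t d \<alpha> by (intro powr_mono2') auto
        then show ?thesis
          using C by (intro mult_right_mono ennreal_leI) auto
      qed simp
    qed
    finally show "ennreal (d * ((2 * T) powr (\<alpha> - 1) * C))
      \<le> (\<integral>\<^sup>+ \<tau>\<in>{s..s + d}. ennreal ((t - \<tau>) powr (\<alpha> - 1) * C) \<partial>lebesgue)" .
  qed
  moreover have "\<alpha> * d * (2 * T) powr (\<alpha> - 1) * (\<eta> / 2 * K_near N) * K powr p = \<alpha> * (d * ((2 * T) powr (\<alpha> - 1) * C))"
    by (simp add: C_def)
  ultimately show "AE x in lebesgue. norm x \<le> T powr (\<alpha> / 2) \<longrightarrow>
      \<alpha> * d * (2 * T) powr (\<alpha> - 1) * (\<eta> / 2 * K_near N) * K powr p \<le> u t x"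
    by (simp only: mem_cball_0)
qed

text \<open>
  The time steps are halved each time, so that they stay below \<open>2 * T\<close>.  The bounds \<open>K * R ^ k\<close> grow with \<open>R\<close> chosen
  so that \<open>R powr (p - 1) = 2\<close> compensates the halving; at time \<open>2 * T\<close> they hold for all \<open>k\<close>, which is
  impossible for a real-valued function on a ball of positive measure.
\<close>

lemma local_bound_contradiction:
  assumes T: "0 < T" and K: "0 < K" and bound: "local_bound T K T"
    and threshold: "4 * 2 powr (N / 2) \<le> \<alpha> * T * (2 * T) powr (\<alpha> - 1) * (\<eta> / 2 * K_near N) * K powr (p - 1)"
  shows False
proof -
  define R where "R = 2 powr (N / 2)"
  have R: "1 < R" using pos(1) by (simp add: R_def)
  have Rp: "(R ^ k) powr (p - 1) = 2 ^ k" for k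
    using pos(1) by (simp add: R_def p powr_power powr_powr powr_realpow)
  have iter: "local_bound T (K * R ^ k) (T * (2 - 1 / 2 ^ k))" for k
  proof (induction k)
    case 0
    then show ?case using bound by simp
  next
    case (Suc k)
    \<comment> \<open>chosen so that \<open>2 * d\<close> is the distance of the times for \<open>k\<close> and \<open>Suc k\<close>\<close>
    define d where "d = T / (4 * 2 ^ k)"
    have "local_bound T (\<alpha> * d * (2 * T) powr (\<alpha> - 1) * (\<eta> / 2 * K_near N) * (K * R ^ k) powr p)
      (T * (2 - 1 / 2 ^ k) + 2 * d)"
    proof (rule local_bound_step[OF T _ _ _ Suc])
      have "1 / 2 ^ k \<le> (1::real)" by simp
      then have "T * 1 \<le> T * (2 - 1 / 2 ^ k)" using T by (intro mult_left_mono) auto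
      then show "T \<le> T * (2 - 1 / 2 ^ k)" by simp
    qed (use T K R in \<open>auto simp: d_def\<close>)
    moreover have "T * (2 - 1 / 2 ^ k) + 2 * d = T * (2 - 1 / 2 ^ Suc k)"
      by (simp add: d_def field_simps)
    moreover have "K * R ^ Suc k \<le> \<alpha> * d * (2 * T) powr (\<alpha> - 1) * (\<eta> / 2 * K_near N) * (K * R ^ k) powr p"
    proof -
      have e: "(K * R ^ k) powr p = K powr (p - 1) * 2 ^ k * (K * R ^ k)"
      proof -
        have "(K * R ^ k) powr p = (K * R ^ k) powr (p - 1) * (K * R ^ k)"
          using K R by (simp add: powr_diff)
        also have "(K * R ^ k) powr (p - 1) = K powr (p - 1) * 2 ^ k"
          using K R by (simp add: powr_mult Rp)
        finally show ?thesis .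
      qed
      have "K * R ^ Suc k = 4 * R * (K * R ^ k) / 4" by simp
      also have "\<dots> \<le> (\<alpha> * T * (2 * T) powr (\<alpha> - 1) * (\<eta> / 2 * K_near N) * K powr (p - 1)) * (K * R ^ k) / 4"
        using threshold K R unfolding R_def[symmetric] by (intro divide_right_mono mult_right_mono) auto
      also have "\<dots> = \<alpha> * d * (2 * T) powr (\<alpha> - 1) * (\<eta> / 2 * K_near N) * (K * R ^ k) powr p"
        unfolding e d_def by (simp add: field_simps)
      finally show ?thesis .
    qed
    ultimately show ?case
      using local_bound_mono by simp
  qed
  have "AE x in lebesgue. norm x \<le> T powr (\<alpha> / 2) \<longrightarrow> K * R ^ k \<le> u (2 * T) x" for k
    using iter[of k] T unfolding local_bound_def by (auto simp: field_simps)
  then have "AE x in lebesgue. \<forall>k. norm x \<le> T powr (\<alpha> / 2) \<longrightarrow> K * R ^ k \<le> u (2 * T) x"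
    by (simp only: AE_all_countable) simp
  then have "AE x in lebesgue. x \<notin> (cball 0 (T powr (\<alpha> / 2)) :: (real ^ 'n) set)"
  proof eventually_elim
    case (elim x)
    obtain k where "u (2 * T) x / K < R ^ k"
      using real_arch_pow[OF R] by auto
    then have "u (2 * T) x < K * R ^ k"
      using K by (simp add: pos_divide_less_eq mult.commute)
    then show ?case using elim[rule_format, of k] by fastforce
  qed
  then have "emeasure lebesgue (cball 0 (T powr (\<alpha> / 2)) :: (real ^ 'n) set) = 0"
    by (subst (asm) AE_iff_measurable[OF _ refl]) (auto simp: cball_def)
  moreover have "0 < \<omega> * (T powr (\<alpha> / 2)) powr N"
    using T pos by simp
  ultimately show False
    by (subst (asm) emeasure_lebesgue_cball) (auto simp: N)
qed

section \<open>The mass threshold\<close>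

text \<open>
  A profile constant \<open>m\<close> bounds \<open>u\<close> below by \<open>K\<close>, a multiple of \<open>m * T powr (- (\<alpha> * N / 2))\<close>, on the
  fixed ball during \<open>[T, 3 * T]\<close>.  The condition for local blow-up involves
  \<open>T powr \<alpha> * K powr (2 / N)\<close>, from which \<open>T\<close> cancels by scaling; a value of \<open>m\<close> independent of \<open>T\<close>
  therefore suffices, although \<open>T\<close> itself depends on \<open>m\<close>.
\<close>

lemma initial_mass_subcritical:
  assumes M: "0 < M" "ennreal M \<le> (\<integral>\<^sup>+ y\<in>cball 0 r. ennreal (u0 y) \<partial>lebesgue)" and r: "0 < r"
  shows "gain * (\<eta> * K_far N * M) powr (p - 1) < 2"
proof (rule ccontr)
  assume threshold: "\<not> gain * (\<eta> * K_far N * M) powr (p - 1) < 2"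
  define B where "B = \<alpha> * 2 powr (\<alpha> - 1) * 3 powr (- \<alpha>) * (\<eta> / 2 * K_near N)"
  have B: "0 < B" using \<alpha> \<eta> pos by (simp add: B_def)
  define m where "m = (4 * 2 powr (N / 2) / B) powr (N / 2)"
  have m: "0 < m" using B by (simp add: m_def)
  have "\<exists>t>0. profile_bound m t"
  proof (rule profile_bound_arbitrarily_large)
    show "profile_bound (\<eta> * K_far N * M) (r powr (2 / \<alpha>))"
      using M r by (intro profile_bound_initial) auto
  qed (use threshold r M \<eta> pos in auto)
  then obtain T where T: "0 < T" "profile_bound m T" by auto
  define K where "K = m * (3 * T) powr (- (\<alpha> * N / 2))"
  have K: "0 < K" using m T by (simp add: K_def)
  have "local_bound T K T"
    unfolding local_bound_def
  proof
    fix t assume t: "t \<in> {T..3 * T}"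
    have "K \<le> m * t powr (- (\<alpha> * N / 2))"
      unfolding K_def using t T m \<alpha> pos by (intro mult_left_mono powr_mono2') auto
    moreover have "T powr (\<alpha> / 2) \<le> t powr (\<alpha> / 2)"
      using t T \<alpha> by (intro powr_mono2) auto
    moreover have "AE x in lebesgue. norm x \<le> t powr (\<alpha> / 2) \<longrightarrow> m * t powr (- (\<alpha> * N / 2)) \<le> u t x"
      using T t by (simp add: profile_bound_def)
    ultimately show "AE x in lebesgue. norm x \<le> T powr (\<alpha> / 2) \<longrightarrow> K \<le> u t x"
      by (auto elim: eventually_mono)
  qed
  moreover have "\<alpha> * T * (2 * T) powr (\<alpha> - 1) * (\<eta> / 2 * K_near N) * K powr (p - 1) = 4 * 2 powr (N / 2)"
  proof -
    have p1: "p - 1 = 2 / N" by (simp add: p)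
    have "K powr (p - 1) = m powr (2 / N) * (3 * T) powr (- \<alpha>)"
      using m T pos(1) unfolding p1 K_def by (simp add: powr_mult powr_powr)
    also have "m powr (2 / N) = 4 * 2 powr (N / 2) / B"
      using B pos(1) by (simp add: m_def powr_powr)
    finally have "K powr (p - 1) = 4 * 2 powr (N / 2) / B * (3 powr (- \<alpha>) * T powr (- \<alpha>))"
      using T by (simp add: powr_mult)
    moreover have time: "T * (2 * T) powr (\<alpha> - 1) = 2 powr (\<alpha> - 1) * T powr \<alpha>"
      using T by (simp add: powr_mult powr_diff)
    moreover have "\<alpha> * T * X * Y * (Z * (a * b)) = (\<alpha> * e * a * Y) * Z * (f * b)"
      if "T * X = e * f" for X Y Z a b e f :: real
    proof -
      have "\<alpha> * T * X * Y * (Z * (a * b)) = (T * X) * (\<alpha> * Y * Z * a * b)"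
        by (simp add: mult_ac)
      then show ?thesis
        unfolding that by (simp add: mult_ac)
    qed
    ultimately have "\<alpha> * T * (2 * T) powr (\<alpha> - 1) * (\<eta> / 2 * K_near N) * K powr (p - 1)
      = B * (4 * 2 powr (N / 2) / B) * (T powr \<alpha> * T powr (- \<alpha>))"
      unfolding B_def by (simp only:)
    moreover have "T powr \<alpha> * T powr (- \<alpha>) = 1"
      using T by (simp flip: powr_add)
    ultimately show ?thesis
      using B by simp
  qed
  ultimately show False
    using local_bound_contradiction[OF T(1) K] by simp
qed

end

lemma ball_carries_mass_above:
  fixes v :: "real ^ 'n \<Rightarrow> real"
  assumes v: "\<And>x. 0 \<le> v x" "v \<in> borel_measurable lebesgue" and M: "M < L1_norm v"
  shows "\<exists>r>0. M < (\<integral>\<^sup>+ y\<in>cball 0 r. ennreal (v y) \<partial>lebesgue)"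
proof -
  let ?f = "\<lambda>n y. ennreal (v y) * indicator (cball 0 (real (Suc n))) y"
  have "L1_norm v = (\<integral>\<^sup>+ y. (SUP n. ?f n y) \<partial>lebesgue)"
    unfolding L1_norm_def
  proof (rule nn_integral_cong)
    fix y :: "real ^ 'n"
    obtain n where n: "norm y < real n" using reals_Archimedean2 by blast
    have "ennreal (v y) \<le> (SUP n. ?f n y)"
      by (rule SUP_upper2[of n]) (use n in auto)
    moreover have "(SUP n. ?f n y) \<le> ennreal (v y)"
      by (rule SUP_least) (auto simp: indicator_def)
    ultimately show "ennreal \<bar>v y\<bar> = (SUP n. ?f n y)"
      using v(1)[of y] by (simp add: antisym)
  qed
  also have "\<dots> = (SUP n. (\<integral>\<^sup>+ y. ?f n y \<partial>lebesgue))"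
  proof (rule nn_integral_monotone_convergence_SUP)
    show "incseq ?f"
      by (auto simp: incseq_def le_fun_def indicator_def)
  next
    fix n
    show "?f n \<in> borel_measurable lebesgue"
      using v(2) by (intro borel_measurable_times_ennreal borel_measurable_indicator measurable_compose[OF _ measurable_ennreal]) auto
  qed
  finally obtain n where "M < (\<integral>\<^sup>+ y. ?f n y \<partial>lebesgue)"
    using M by (auto simp: less_SUP_iff)
  then show ?thesis by (intro exI[of _ "real (Suc n)"]) auto
qed

text \<open>
  The solution for \<open>C\<close> of \<open>gain * (\<eta> * K_far N * M) powr (2 / N) = 2\<close> with \<open>M = C * (1 - \<alpha>) powr (N / 2)\<close>.
\<close>

definition mass_const :: "real \<Rightarrow> real \<Rightarrow> real" where
  "mass_const N \<eta> = (32 / (\<eta> * K_far N * unit_ball_vol N * (\<eta> * K_far N) powr (2 / N))) powr (N / 2)"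

lemma L1_norm_global_data_le:
  fixes v :: "real ^ 'n \<Rightarrow> real"
  defines "N \<equiv> real CARD('n)"
  assumes \<alpha>: "1 / 2 < \<alpha>" "\<alpha> < 1"
    and \<eta>: "0 < \<eta>" "ennreal \<eta> \<le> (\<integral>\<^sup>+ \<theta>\<in>{1/2..3/2}. ennreal (h \<alpha> \<theta>) \<partial>lebesgue)"
    and v: "v \<in> global_data (1 + 2 / N) \<alpha>"
  shows "L1_norm v \<le> ennreal (mass_const N \<eta> * (1 - \<alpha>) powr (N / 2))"
proof (rule ccontr)
  define M where "M = mass_const N \<eta> * (1 - \<alpha>) powr (N / 2)"
  assume "\<not> L1_norm v \<le> ennreal (mass_const N \<eta> * (1 - \<alpha>) powr (N / 2))"
  then have less: "ennreal M < L1_norm v" by (simp add: M_def)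
  obtain u where u: "is_solution \<alpha> (1 + 2 / N) \<infinity> v u" and v': "\<And>x. 0 \<le> v x" "v \<in> borel_measurable lebesgue"
    using v unfolding global_data_def by auto
  interpret critical_global_solution N \<alpha> "1 + 2 / N" \<eta> v u
    using \<alpha> \<eta> u by unfold_locales (auto simp: N_def)
  obtain r where r: "0 < r" "ennreal M < (\<integral>\<^sup>+ y\<in>cball 0 r. ennreal (v y) \<partial>lebesgue)"
    using ball_carries_mass_above[OF v' less] by auto
  define k where "k = \<eta> * K_far N"
  have k: "0 < k" using \<eta> pos by (simp add: k_def)
  have M: "0 < M" using \<alpha> k less_imp_neq[OF pos(2)] by (simp add: M_def mass_const_def k_def[symmetric])
  have "gain * (k * M) powr (2 / N) < 2"
    using initial_mass_subcritical[OF M _ r(1)] r(2) by (simp add: k_def)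
  moreover have "(k * M) powr (2 / N) = k powr (2 / N) * (32 / (k * \<omega> * k powr (2 / N))) * (1 - \<alpha>)"
    using \<alpha> k pos unfolding M_def mass_const_def k_def[symmetric] by (simp add: powr_mult powr_powr)
  moreover have "gain = k * \<omega> / (16 * (1 - \<alpha>))"
    by (simp add: gain_def k_def)
  moreover have "k * \<omega> / (16 * (1 - \<alpha>)) * (k powr (2 / N) * (32 / (k * \<omega> * k powr (2 / N))) * (1 - \<alpha>)) = 2"
  proof -
    have "k * \<omega> / (16 * e) * (a * (32 / (k * \<omega> * a)) * e) = 2" if "0 < e" "0 < a" for a e
      using that k less_imp_neq[OF pos(2)] by simp
    from this[of "1 - \<alpha>" "k powr (2 / N)"] show ?thesis
      using k \<alpha> by simp
  qed
  ultimately show False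
    by (simp only: less_irrefl)
qed

theorem theorem2:
  fixes p :: real
  assumes "p = 1 + 2 / real CARD('n)"
  shows "(\<exists>C>0. \<exists>\<alpha>\<^sub>0\<in>{0<..<1}. \<forall>\<alpha>\<in>{\<alpha>\<^sub>0<..<1}.
            (SUP v \<in> (global_data p \<alpha> :: (real ^ 'n \<Rightarrow> real) set). L1_norm v)
              \<le> ennreal (C * (1 - \<alpha>) powr (real CARD('n) / 2)))
       \<and> ((\<lambda>\<alpha>. SUP v \<in> (global_data p \<alpha> :: (real ^ 'n \<Rightarrow> real) set). L1_norm v)
            \<longlongrightarrow> 0) (at_left 1)"
proof -
  define N where "N = real CARD('n)"
  let ?sup = "\<lambda>\<alpha>. SUP v \<in> (global_data p \<alpha> :: (real ^ 'n \<Rightarrow> real) set). L1_norm v"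
  obtain \<eta> where \<eta>: "0 < \<eta>"
      "\<forall>\<^sub>F \<alpha> in at_left 1. ennreal \<eta> \<le> (\<integral>\<^sup>+ \<theta>\<in>{1/2..3/2}. ennreal (h \<alpha> \<theta>) \<partial>lebesgue)"
    using nn_integral_h_near_1_lower_bound by blast
  then obtain \<alpha>\<^sub>1 where \<alpha>\<^sub>1: "\<alpha>\<^sub>1 < 1"
      "\<And>\<alpha>. \<alpha>\<^sub>1 < \<alpha> \<Longrightarrow> \<alpha> < 1 \<Longrightarrow> ennreal \<eta> \<le> (\<integral>\<^sup>+ \<theta>\<in>{1/2..3/2}. ennreal (h \<alpha> \<theta>) \<partial>lebesgue)"
    unfolding eventually_at_left[OF zero_less_one] by blast
  define C where "C = mass_const N \<eta>"
  define \<alpha>\<^sub>0 where "\<alpha>\<^sub>0 = max (1 / 2) \<alpha>\<^sub>1"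
  have "0 < N" by (simp add: N_def)
  then have "0 < unit_ball_vol N" by simp
  from less_imp_neq[OF this] have C: "0 < C"
    using \<eta>(1) by (simp add: C_def mass_const_def K_far_def)
  have \<alpha>\<^sub>0: "\<alpha>\<^sub>0 \<in> {0<..<1}" using \<alpha>\<^sub>1(1) by (auto simp: \<alpha>\<^sub>0_def)
  have bound: "?sup \<alpha> \<le> ennreal (C * (1 - \<alpha>) powr (N / 2))" if "\<alpha> \<in> {\<alpha>\<^sub>0<..<1}" for \<alpha>
    using that \<alpha>\<^sub>1(2)[of \<alpha>] \<eta>(1) assms unfolding C_def N_def
    by (intro SUP_least L1_norm_global_data_le) (auto simp: \<alpha>\<^sub>0_def)
  have "((\<lambda>\<alpha>. C * (1 - \<alpha>) powr (N / 2)) \<longlongrightarrow> C * (1 - 1) powr (N / 2)) (at_left 1)"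
    using \<open>0 < N\<close> by (intro tendsto_intros tendsto_powr') (auto simp: eventually_at_filter)
  then have "((\<lambda>\<alpha>. C * (1 - \<alpha>) powr (N / 2)) \<longlongrightarrow> 0) (at_left 1)"
    by simp
  from tendsto_ennrealI[OF this]
  have lim: "((\<lambda>\<alpha>. ennreal (C * (1 - \<alpha>) powr (N / 2))) \<longlongrightarrow> 0) (at_left 1)"
    by simp
  have "\<forall>\<^sub>F \<alpha> in at_left 1. \<alpha> \<in> {\<alpha>\<^sub>0<..<1}"
    using \<alpha>\<^sub>0 by (intro eventually_at_left_real) auto
  then have "\<forall>\<^sub>F \<alpha> in at_left 1. ?sup \<alpha> \<le> ennreal (C * (1 - \<alpha>) powr (N / 2))"
    by eventually_elim (rule bound)
  then have "(?sup \<longlongrightarrow> 0) (at_left 1)"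
    by (intro tendsto_sandwich[OF _ _ tendsto_const lim]) auto
  with C \<alpha>\<^sub>0 bound show ?thesis
    unfolding N_def by blast
qed

end
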